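(* Let $\mathbb T=[0,1]^d/\sim$ be the $d$-dimensional torus, $\eta_s$ a Poisson process on $\mathbb T$ with intensity measure $\lambda_s(\mathrm dx)=s\,\mathrm dx$, and $r_s\in(0,1/2)$ with $sr_s^d\to\infty$ as $s\to\infty$. Let $k\ge 2$ and let $\Gamma$ be a fixed feasible connected graph on $k$ vertices. Let $$J_s(\Gamma)=\frac1{k!}\sum_{(x_1,\dots,x_k)\in\eta_s^{\neq,k}}f_s(x_{1:k},\eta_s),\qquad f_s(x_{1:k},\eta_s)=\mathbf 1\big(x_{1:k}\cong\Gamma\ \wedge\ d(x_{1:k},\eta_s\setminus x_{1:k})>r_s\big),$$ the number of $\Gamma$-components of the random geometric graph on $\eta_s$ with radius $r_s$. Then there is a constant $C\in(0,\infty)$ depending only on $d$ and $k$ such that $$\operatorname{Var}(J_s(\eta_s))\le\frac{C}{sr_s^d}\,\mathbb E\int_{\mathbb T}(D_xJ_s(\eta_s))^2\,\lambda_s(\mathrm dx).$$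
   Context: The random geometric graph on a finite set $X\subset\mathbb T$ with radius $r$ joins distinct $x,y\in X$ iff $\|x-y\|\le r$ (torus distance). $x_{1:k}=\{x_1,\dots,x_k\}$; $x_{1:k}\cong\Gamma$ means the geometric graph on $x_{1:k}$ with radius $r_s$ is isomorphic to $\Gamma$. For finite $X,Y$, $d(X,Y)=\min_{x\in X,y\in Y}\|x-y\|$. $\eta_s^{\neq,k}$ is the set of ordered $k$-tuples of distinct points of $\eta_s$. $\Gamma$ is feasible if it can arise (with positive probability) as the geometric graph of $k$ points, i.e. the set of $(x_1,\dots,x_k)$ whose geometric graph is isomorphic to $\Gamma$ has positive Lebesgue measure. $D_xF(\mu)=F(\mu+\delta_x)-F(\mu)$. *)

theory Defs
  imports "HOL-Analysis.Analysis"
begin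

text \<open>The torus T = [0,1)^d / ~ , represented by the fundamental domain
  [0,1)^d inside real^'d (d = CARD('d)), with the torus distance.\<close>

definition unit_cube :: "(real^'d) set" where
  "unit_cube = {x. \<forall>i. 0 \<le> x$i \<and> x$i < 1}"

definition tdist :: "real^'d \<Rightarrow> real^'d \<Rightarrow> real" where
  "tdist x y = Inf {norm (x - y - z) | z. \<forall>i. z$i \<in> \<int>}"

definition torus_meas :: "(real^'d) measure" where
  "torus_meas = restrict_space lborel unit_cube"

definition is_graph :: "nat \<Rightarrow> (nat \<Rightarrow> nat \<Rightarrow> bool) \<Rightarrow> bool" where
  "is_graph k G \<longleftrightarrow> (\<forall>i j. G i j \<longrightarrow> i < k \<and> j < k \<and> i \<noteq> j \<and> G j i)"

definition connected_graph :: "nat \<Rightarrow> (nat \<Rightarrow> nat \<Rightarrow> bool) \<Rightarrow> bool" where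
  "connected_graph k G \<longleftrightarrow> (\<forall>i<k. \<forall>j<k. G\<^sup>*\<^sup>* i j)"

definition geo_iso :: "real \<Rightarrow> nat \<Rightarrow> (nat \<Rightarrow> nat \<Rightarrow> bool) \<Rightarrow> (nat \<Rightarrow> real^'d) \<Rightarrow> bool" where
  "geo_iso r k G x \<longleftrightarrow> (\<exists>\<sigma>. bij_betw \<sigma> {..<k} {..<k} \<and>
     (\<forall>i<k. \<forall>j<k. i \<noteq> j \<longrightarrow> (tdist (x i) (x j) \<le> r \<longleftrightarrow> G (\<sigma> i) (\<sigma> j))))"

definition feasible :: "'d::finite itself \<Rightarrow> real \<Rightarrow> nat \<Rightarrow> (nat \<Rightarrow> nat \<Rightarrow> bool) \<Rightarrow> bool" where
  "feasible _ r k G \<longleftrightarrow>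
     emeasure (PiM {..<k} (\<lambda>_. (torus_meas :: (real^'d) measure)))
       {x \<in> space (PiM {..<k} (\<lambda>_. (torus_meas :: (real^'d) measure))).
          inj_on x {..<k} \<and> geo_iso r k G x} > 0"

definition Jcomp :: "real \<Rightarrow> nat \<Rightarrow> (nat \<Rightarrow> nat \<Rightarrow> bool) \<Rightarrow> (real^'d) set \<Rightarrow> real" where
  "Jcomp r k G X = (1 / fact k) * real (card
     {x \<in> {..<k} \<rightarrow>\<^sub>E X. inj_on x {..<k} \<and> geo_iso r k G x \<and>
        (\<forall>y \<in> X - x ` {..<k}. \<forall>i<k. tdist (x i) y > r)})"

definition addone :: "((real^'d) set \<Rightarrow> real) \<Rightarrow> real^'d \<Rightarrow> (real^'d) set \<Rightarrow> real" where
  "addone F x X = F (insert x X) - F X"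

text \<open>Expectation of a functional of the Poisson process eta_s with intensity s dx on
  the torus: the number of points is Poisson(s), and given n points they are i.i.d.
  uniform on the torus.\<close>
definition pp_expect :: "real \<Rightarrow> ((real^'d) set \<Rightarrow> real) \<Rightarrow> real" where
  "pp_expect s F = (\<Sum>n. exp (- s) * s ^ n / fact n *
      (\<integral>x. F (x ` {..<n}) \<partial>(PiM {..<n} (\<lambda>_. (torus_meas :: (real^'d) measure)))))"

definition pp_var :: "real \<Rightarrow> ((real^'d) set \<Rightarrow> real) \<Rightarrow> real" where
  "pp_var s F = pp_expect s (\<lambda>X. (F X - pp_expect s F)\<^sup>2)"

end

theory Submission
  imports Defs "HOL-Probability.Infinite_Product_Measure"
begin

text \<open>
  Let \<open>N = k! J\<close> count the ordered isolated \<open>k\<close>-tuples forming a copy of \<open>\<Gamma>\<close>. Both sides are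
  compared with \<open>E N\<close>, uniformly in \<open>s\<close> and \<open>r\<close>.

  Upper bound. Up to the at most \<open>k ^ k\<close> tuples that share their point set with a given one,
  \<open>N\<^sup>2\<close> counts pairs of disjoint tuples \<open>x, y\<close>. By the Mecke formula these have expectation
  \<open>s ^ (2 k) \<integral>\<integral> exp (- s |B x \<union> B y|)\<close>, where \<open>B x\<close> is the \<open>r\<close>-neighbourhood of \<open>x\<close>. Pairs with
  \<open>B x\<close> and \<open>B y\<close> disjoint contribute at most \<open>(E N)\<^sup>2\<close>. For the others
  \<open>s ^ k \<integral> exp (- s |B y - B x|) dy\<close> over \<open>y\<close> near \<open>x\<close> and outside \<open>B x\<close> is bounded by a
  constant, whence \<open>Var N \<le> C E N\<close>.

  Lower bound. Adding a point within distance \<open>r\<close> of a component destroys it, and the component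
  then created has more than \<open>k\<close> points. So \<open>(D N)\<^sup>2\<close> is at least the number of destroyed tuples,
  and its integral is at least a constant times \<open>r ^ d N\<close>.
\<close>

subsection \<open>Volumes of torus balls\<close>

text \<open>The delicate quantity is \<open>s ^ k\<close> times the integral of
  \<open>exp (- s |B y - B x|)\<close> over the \<open>y\<close> near \<open>x\<close> and outside
  \<open>B x\<close>. Bounding the exponential by 1 leaves a factor of order
  \<open>(s r ^ d) ^ k\<close>, which is not bounded. Nor does \<open>|B y - B x|\<close> admit a
  lower bound of order \<open>r ^ d\<close> in general: when the points of \<open>x\<close> surround
  those of \<open>y\<close> at distances just above \<open>r\<close>, almost nothing of
  \<open>B y\<close> is new. What saves the estimate is that points of a set \<open>A\<close> with
  little of \<open>A\<close> around them fill little volume. \<open>packing_bound\<close> makes this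
  quantitative for every Borel set \<open>A\<close>, so the geometry of unions of balls never
  enters; it is applied with \<open>A\<close> the complement of \<open>B x\<close>. Expectations are
  Poisson mixtures of integrals over \<open>n\<close> labelled points, and functionals see only the
  set of values. Hence counting is done for injective samples, which have full measure, whereas
  measurability must hold for all samples, including those with repeated points.\<close>

lemma tdist_infdist: "tdist x y = infdist (x - y) {z. \<forall>i. z$i \<in> \<int>}"
proof -
  have ne: "{z::real^'d. \<forall>i. z$i \<in> \<int>} \<noteq> {}"
    using exI[of "\<lambda>z::real^'d. \<forall>i. z$i \<in> \<int>" 0] by simp
  have "{norm (x - y - z) | z. \<forall>i. z$i \<in> \<int>} = dist (x - y) ` {z. \<forall>i. z$i \<in> \<int>}"
    by (auto simp: dist_norm image_iff)
  then show ?thesis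
    by (simp add: tdist_def infdist_notempty[OF ne])
qed

lemma tdist_le_norm: "(\<forall>i. z$i \<in> \<int>) \<Longrightarrow> tdist x y \<le> norm (x - y - z)"
  unfolding tdist_infdist by (rule order_trans[OF infdist_le[of z]]) (auto simp: dist_norm)

lemma tdist_nonneg: "0 \<le> tdist x y"
  unfolding tdist_infdist by (rule infdist_nonneg)

lemma tdist_self [simp]: "tdist x x = 0"
  using tdist_le_norm[of 0 x x] tdist_nonneg[of x x] by simp

text \<open>It replaces attainment of the infimum: a strict upper bound already yields a lattice
  vector. This is why symmetry and the triangle inequality are proved up to an arbitrary
  \<open>e\<close>.\<close>

lemma tdist_lessE:
  assumes "tdist x y < e"
  obtains z where "\<forall>i. z$i \<in> \<int>" "norm (x - y - z) < e"
proof -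
  have "infdist (x - y) {z. \<forall>i. z$i \<in> \<int>} < e" using assms by (simp add: tdist_infdist)
  moreover have ne: "{z::real^'d. \<forall>i. z$i \<in> \<int>} \<noteq> {}"
    using exI[of "\<lambda>z::real^'d. \<forall>i. z$i \<in> \<int>" 0] by simp
  ultimately have "\<exists>z\<in>{z. \<forall>i. z$i \<in> \<int>}. dist (x - y) z < e"
    using cINF_less_iff[OF ne, of "dist (x - y)" e] by (auto simp: infdist_notempty[OF ne])
  then show ?thesis using that by (auto simp: dist_norm)
qed

lemma tdist_commute: "tdist x y = tdist y x"
proof -
  have "tdist x y \<le> tdist y x" for x y :: "real^'d"
  proof (rule field_le_epsilon)
    fix e :: real assume "e > 0"
    then obtain z where z: "\<forall>i. z$i \<in> \<int>" "norm (y - x - z) < tdist y x + e"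
      by (metis tdist_lessE less_add_same_cancel1)
    have "tdist x y \<le> norm (x - y - (- z))" using z by (intro tdist_le_norm) auto
    also have "\<dots> = norm (y - x - z)" using norm_minus_cancel[of "y - x - z"] by (simp add: algebra_simps)
    finally show "tdist x y \<le> tdist y x + e" using z by simp
  qed
  then show ?thesis by (metis order_antisym)
qed

lemma tdist_triangle: "tdist x z \<le> tdist x y + tdist y z"
proof (rule field_le_epsilon)
  fix e :: real assume "e > 0"
  then have e: "e / 2 > 0" by simp
  obtain u where u: "\<forall>i. u$i \<in> \<int>" "norm (x - y - u) < tdist x y + e / 2"
    using tdist_lessE[of x y "tdist x y + e / 2"] e by auto
  obtain v where v: "\<forall>i. v$i \<in> \<int>" "norm (y - z - v) < tdist y z + e / 2"
    using tdist_lessE[of y z "tdist y z + e / 2"] e by auto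
  have "tdist x z \<le> norm (x - z - (u + v))" using u v by (intro tdist_le_norm) auto
  also have "x - z - (u + v) = (x - y - u) + (y - z - v)" by simp
  also have "norm \<dots> \<le> norm (x - y - u) + norm (y - z - v)" by (rule norm_triangle_ineq)
  finally show "tdist x z \<le> tdist x y + tdist y z + e" using u v by simp
qed

text \<open>The distance to a fixed set is continuous, so the form as \<open>infdist\<close> to the
  integer lattice gives measurability without inspecting the infimum.\<close>

lemma borel_measurable_tdist [measurable (raw)]:
  assumes [measurable]: "f \<in> borel_measurable N" "g \<in> borel_measurable N"
  shows "(\<lambda>w. tdist (f w) (g w)) \<in> borel_measurable N"
proof -
  have "continuous_on UNIV (\<lambda>x::real^'d. infdist x {z. \<forall>i. z$i \<in> \<int>})"
    by (intro continuous_intros)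
  then have [measurable]: "(\<lambda>x::real^'d. infdist x {z. \<forall>i. z$i \<in> \<int>}) \<in> borel_measurable borel"
    by (rule borel_measurable_continuous_onI)
  show ?thesis unfolding tdist_infdist by measurable
qed

section \<open>The torus measure as Lebesgue measure on the fundamental cube\<close>

lemma unit_cube_borel [measurable]: "unit_cube \<in> sets borel"
  unfolding unit_cube_def by measurable

lemma space_torus_meas [simp]: "space torus_meas = unit_cube"
  by (simp add: torus_meas_def space_restrict_space)

lemma emeasure_lborel_cube:
  fixes a :: "real^'d"
  assumes "0 \<le> \<delta>"
  shows "emeasure lborel (box a (\<chi> i. a$i + \<delta>)) = ennreal (\<delta> ^ CARD('d))"
    and "emeasure lborel (cbox a (\<chi> i. a$i + \<delta>)) = ennreal (\<delta> ^ CARD('d))"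
proof -
  have B: "(Basis :: (real^'d) set) = range (\<lambda>i. axis i 1)"
    by (auto simp: Basis_vec_def)
  have inj: "inj (\<lambda>i. axis i (1::real) :: real^'d)" by (auto simp: inj_on_def axis_eq_axis)
  let ?b = "(\<chi> i. a$i + \<delta>) :: real^'d"
  have "(\<Prod>u\<in>Basis. (?b - a) \<bullet> u) = (\<Prod>i\<in>UNIV. (?b - a) $ i)"
    unfolding B by (subst prod.reindex[OF inj]) (simp add: inner_axis)
  then have prod: "(\<Prod>u\<in>Basis. (?b - a) \<bullet> u) = \<delta> ^ CARD('d)" by simp
  have le: "a \<bullet> u \<le> ?b \<bullet> u" if "u \<in> Basis" for u
    using that assms by (auto simp: B inner_axis)
  show "emeasure lborel (box a ?b) = ennreal (\<delta> ^ CARD('d))"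
    by (subst emeasure_lborel_box[OF le]) (simp_all only: prod)
  show "emeasure lborel (cbox a ?b) = ennreal (\<delta> ^ CARD('d))"
    by (subst emeasure_lborel_cbox[OF le]) (simp_all only: prod)
qed

lemma emeasure_unit_cube: "emeasure lborel (unit_cube :: (real^'d) set) = 1"
proof (rule antisym)
  have "emeasure lborel (unit_cube :: (real^'d) set) \<le> emeasure lborel (cbox (0::real^'d) (\<chi> i. 0$i + 1))"
    by (rule emeasure_mono) (auto simp: unit_cube_def mem_box_cart less_imp_le)
  then show "emeasure lborel (unit_cube :: (real^'d) set) \<le> 1"
    by (subst (asm) emeasure_lborel_cube) auto
  have "emeasure lborel (box (0::real^'d) (\<chi> i. 0$i + 1)) \<le> emeasure lborel (unit_cube :: (real^'d) set)"
    by (rule emeasure_mono) (auto simp: unit_cube_def mem_box_cart less_imp_le)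
  then show "1 \<le> emeasure lborel (unit_cube :: (real^'d) set)"
    by (subst (asm) emeasure_lborel_cube) auto
qed

lemma prob_space_torus_meas: "prob_space (torus_meas :: (real^'d) measure)"
  by (rule prob_spaceI)
    (simp add: torus_meas_def emeasure_restrict_space space_restrict_space emeasure_unit_cube)

interpretation torus: prob_space "torus_meas :: (real^'d) measure"
  by (rule prob_space_torus_meas)

lemma measurable_id_torus: "(\<lambda>x. x) \<in> torus_meas \<rightarrow>\<^sub>M borel"
  unfolding torus_meas_def by (intro measurable_restrict_space1) simp

lemma sets_torus_Int: "A \<in> sets borel \<Longrightarrow> A \<inter> unit_cube \<in> sets torus_meas"
  by (auto simp: torus_meas_def sets_restrict_space)

lemma emeasure_torus_meas:
  assumes "A \<in> sets borel" shows "emeasure torus_meas (A \<inter> unit_cube) = emeasure lborel (A \<inter> unit_cube)"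
  unfolding torus_meas_def by (subst emeasure_restrict_space) (use assms in auto)

lemma tdist_ball_borel [measurable]: "{y. tdist x y \<le> \<rho>} \<in> sets borel"
  by measurable

lemma emeasure_torus_singleton: "emeasure torus_meas {x} = 0"
proof (cases "x \<in> unit_cube")
  case True
  then have "emeasure torus_meas ({x} \<inter> unit_cube) = 0" by (subst emeasure_torus_meas) auto
  with True show ?thesis by simp
qed (auto intro!: emeasure_notin_sets dest: sets.sets_into_space)

text \<open>A cube of side \<open>\<rho> / d\<close> with \<open>x\<close> as a corner lies in the
  ball, because the Euclidean norm is at most the sum of the \<open>d\<close> coordinate distances.
  This is where the \<open>CARD('d)\<close> in the denominator comes from.\<close>

lemma tball_volume_lower:
  fixes x :: "real^'d"
  assumes x: "x \<in> unit_cube" and \<rho>: "0 < \<rho>" "\<rho> < 1/2"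
  shows "(\<rho> / CARD('d)) ^ CARD('d) \<le> measure torus_meas ({y. tdist x y \<le> \<rho>} \<inter> unit_cube)"
proof -
  define n where "n = CARD('d)"
  have n: "n \<ge> 1" by (simp add: n_def Suc_leI)
  define \<delta> where "\<delta> = \<rho> / n"
  have \<delta>: "0 < \<delta>" "\<delta> < 1/2"
  proof -
    show "0 < \<delta>" using \<rho> n by (simp add: \<delta>_def)
    have "\<rho> / n \<le> \<rho>" using \<rho> n by (simp add: field_simps)
    then show "\<delta> < 1/2" using \<rho>(2) unfolding \<delta>_def by (rule le_less_trans)
  qed
  \<comment> \<open>In each coordinate the cube extends from \<open>x\<close> towards the farther
    face of the fundamental domain. As \<open>\<delta> < 1/2\<close>, it never leaves the domain and
    no wrap-around has to be handled.\<close>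
  define a :: "real^'d" where "a = (\<chi> i. if x$i < 1/2 then x$i else x$i - \<delta>)"
  define b :: "real^'d" where "b = (\<chi> i. a$i + \<delta>)"
  have xr: "0 \<le> x$i" "x$i < 1" for i using x by (auto simp: unit_cube_def)
  have sub: "box a b \<subseteq> {y. tdist x y \<le> \<rho>} \<inter> unit_cube"
  proof
    fix y assume y: "y \<in> box a b"
    then have yi: "a$i < y$i" "y$i < a$i + \<delta>" for i by (auto simp: mem_box_cart b_def)
    have "norm (x - y) \<le> (\<Sum>i\<in>UNIV. \<bar>(x - y)$i\<bar>)" by (rule norm_le_l1_cart)
    also have "\<dots> \<le> (\<Sum>i\<in>(UNIV::'d set). \<delta>)"
    proof (rule sum_mono)
      fix i show "\<bar>(x - y)$i\<bar> \<le> \<delta>" using yi[of i] by (auto simp: a_def split: if_splits)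
    qed
    also have "\<dots> = \<rho>" using n by (simp add: \<delta>_def n_def)
    finally have "tdist x y \<le> \<rho>" using tdist_le_norm[of 0 x y] by simp
    moreover have "0 \<le> y$i \<and> y$i < 1" for i
      using yi[of i] xr[of i] \<delta> by (auto simp: a_def split: if_splits)
    ultimately show "y \<in> {y. tdist x y \<le> \<rho>} \<inter> unit_cube" by (auto simp: unit_cube_def)
  qed
  have "ennreal (\<delta> ^ n) = emeasure lborel (box a b)"
    unfolding b_def n_def using \<delta> by (subst emeasure_lborel_cube) auto
  also have "\<dots> \<le> emeasure lborel ({y. tdist x y \<le> \<rho>} \<inter> unit_cube)"
    by (intro emeasure_mono sub) measurable
  also have "\<dots> = emeasure torus_meas ({y. tdist x y \<le> \<rho>} \<inter> unit_cube)"
    by (rule emeasure_torus_meas[symmetric]) measurable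
  finally show ?thesis
    by (simp add: \<delta>_def n_def torus.emeasure_eq_measure)
qed

text \<open>Two points of the cube that are close on the torus are close in space after a shift by a
  lattice vector with entries -1, 0 or 1. So \<open>3 ^ d\<close> cubes of side
  \<open>4 * \<rho>\<close> cover the ball, whence 12 = 3 * 4. From \<open>\<rho> = 1/2\<close> on,
  the bound exceeds the total mass 1.\<close>

lemma tball_volume_upper:
  fixes x :: "real^'d"
  assumes x: "x \<in> unit_cube" and \<rho>: "0 < \<rho>"
  shows "measure torus_meas ({y. tdist x y \<le> \<rho>} \<inter> unit_cube) \<le> (12 * \<rho>) ^ CARD('d)"
proof (cases "\<rho> < 1/2")
  case False
  have "measure torus_meas ({y. tdist x y \<le> \<rho>} \<inter> unit_cube) \<le> 1" by simp
  also have "\<dots> \<le> (12 * \<rho>) ^ CARD('d)" using False by (intro one_le_power) auto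
  finally show ?thesis .
next
  case True
  define n where "n = CARD('d)"
  define Z :: "(real^'d) set" where "Z = {z. \<forall>i. z$i \<in> {-1, 0, 1}}"
  have Zimg: "Z = (\<lambda>f. \<chi> i. f i) ` (UNIV \<rightarrow>\<^sub>E {-1, 0, 1})"
  proof (intro set_eqI iffI)
    fix z assume "z \<in> Z"
    then show "z \<in> (\<lambda>f. \<chi> i. f i) ` (UNIV \<rightarrow>\<^sub>E {-1, 0, 1})"
      by (intro image_eqI[of _ _ "\<lambda>i. z$i"]) (auto simp: Z_def)
  qed (auto simp: Z_def PiE_def Pi_def)
  have fin: "finite Z" unfolding Zimg by (intro finite_imageI finite_PiE) auto
  have cardZ: "card Z \<le> 3 ^ n"
  proof -
    have "card Z \<le> card ((UNIV::'d set) \<rightarrow>\<^sub>E {-1, 0, 1::real})"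
      unfolding Zimg by (intro card_image_le finite_PiE) auto
    also have "\<dots> = 3 ^ n" by (subst card_PiE) (auto simp: n_def numeral_3_eq_3)
    finally show ?thesis .
  qed
  define a where "a z = (\<chi> i. (x - z)$i - 2 * \<rho>)" for z :: "real^'d"
  define b where "b z = (\<chi> i. a z$i + 4 * \<rho>)" for z :: "real^'d"
  have sub: "{y. tdist x y \<le> \<rho>} \<inter> unit_cube \<subseteq> (\<Union>z\<in>Z. cbox (a z) (b z))"
  proof
    fix y assume y: "y \<in> {y. tdist x y \<le> \<rho>} \<inter> unit_cube"
    \<comment> \<open>The radius is doubled to make the inequality strict, as
      \<open>tdist_lessE\<close> demands. The minimum with 1 keeps each entry of the lattice vector
      below 2 in absolute value.\<close>
    then have "tdist x y < min 1 (2 * \<rho>)" using \<rho> True by auto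
    then obtain z where z: "\<forall>i. z$i \<in> \<int>" "norm (x - y - z) < min 1 (2 * \<rho>)"
      by (rule tdist_lessE)
    have comp: "\<bar>x$i - y$i - z$i\<bar> < min 1 (2 * \<rho>)" for i
      using component_le_norm_cart[of "x - y - z" i] z(2) by simp
    have "z$i \<in> {-1, 0, 1}" for i
    proof -
      obtain m where m: "z$i = of_int m" using z(1) by (metis Ints_cases)
      have "\<bar>x$i - y$i\<bar> < 1" using x y by (simp add: unit_cube_def abs_less_iff) (smt (verit))
      then have "\<bar>z$i\<bar> < 2" using comp[of i] by linarith
      then have "\<bar>m\<bar> < 2" using m by linarith
      then have "m = -1 \<or> m = 0 \<or> m = 1" by arith
      then show ?thesis using m by auto
    qed
    then have "z \<in> Z" by (auto simp: Z_def)
    moreover have "y \<in> cbox (a z) (b z)"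
    proof -
      have "a z $ i \<le> y $ i \<and> y $ i \<le> b z $ i" for i
        using comp[of i] by (auto simp: a_def b_def)
      then show ?thesis by (auto simp: mem_box_cart)
    qed
    ultimately show "y \<in> (\<Union>z\<in>Z. cbox (a z) (b z))" by auto
  qed
  have vol: "emeasure lborel (cbox (a z) (b z)) = ennreal ((4 * \<rho>) ^ n)" for z
    unfolding b_def n_def using \<rho> by (subst emeasure_lborel_cube) auto
  have "emeasure torus_meas ({y. tdist x y \<le> \<rho>} \<inter> unit_cube) = emeasure lborel ({y. tdist x y \<le> \<rho>} \<inter> unit_cube)"
    by (rule emeasure_torus_meas) measurable
  also have "\<dots> \<le> emeasure lborel (\<Union>z\<in>Z. cbox (a z) (b z))"
    by (intro emeasure_mono sub) (use fin in auto)
  also have "\<dots> \<le> (\<Sum>z\<in>Z. emeasure lborel (cbox (a z) (b z)))"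
    by (rule emeasure_subadditive_finite[OF fin]) auto
  also have "\<dots> = of_nat (card Z) * ennreal ((4 * \<rho>) ^ n)" by (simp add: vol)
  also have "\<dots> = ennreal (card Z * (4 * \<rho>) ^ n)" using \<rho> by (simp add: ennreal_mult ennreal_of_nat_eq_real_of_nat)
  also have "\<dots> \<le> ennreal (3 ^ n * (4 * \<rho>) ^ n)"
  proof (intro ennreal_leI mult_right_mono)
    show "real (card Z) \<le> 3 ^ n" using of_nat_mono[OF cardZ, where 'a = real] by simp
  qed (use \<rho> in auto)
  also have "3 ^ n * (4 * \<rho>) ^ n = (12 * \<rho>) ^ n" by (subst power_mult_distrib[symmetric]) simp
  finally show ?thesis using \<rho> by (simp add: n_def torus.emeasure_eq_measure)
qed

subsection \<open>Isolated tuples\<close>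

abbreviation tpow :: "nat \<Rightarrow> (nat \<Rightarrow> real^'d) measure" where
  "tpow n \<equiv> PiM {..<n} (\<lambda>_. torus_meas)"

interpretation tprod: product_sigma_finite "\<lambda>_::nat. torus_meas :: (real^'d) measure"
  by unfold_locales

lemma prob_space_tpow: "prob_space (PiM I (\<lambda>_. torus_meas :: (real^'d) measure))"
  by (intro prob_space_PiM prob_space_torus_meas)

lemma measurable_torus_borel: "f \<in> N \<rightarrow>\<^sub>M torus_meas \<Longrightarrow> f \<in> borel_measurable N"
  by (drule measurable_compose[OF _ measurable_id_torus]) simp

lemma measurable_tpow_component:
  "i \<in> I \<Longrightarrow> (\<lambda>x. x i) \<in> PiM I (\<lambda>_. torus_meas :: (real^'d) measure) \<rightarrow>\<^sub>M borel"
  by (intro measurable_torus_borel measurable_component_singleton)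

lemma measurable_vec_eq [measurable (raw)]:
  fixes f g :: "'a \<Rightarrow> real^'d"
  assumes "f \<in> borel_measurable M" "g \<in> borel_measurable M"
  shows "Measurable.pred M (\<lambda>w. f w = g w)"
  unfolding pred_def using measurable_equality_set[OF assms] .

definition cover :: "real \<Rightarrow> nat \<Rightarrow> (nat \<Rightarrow> real^'d) \<Rightarrow> (real^'d) set" where
  "cover r m t = {y. \<exists>i<m. tdist (t i) y \<le> r}"

definition cvol :: "real \<Rightarrow> nat \<Rightarrow> (nat \<Rightarrow> real^'d) \<Rightarrow> real" where
  "cvol r m t = measure torus_meas (cover r m t \<inter> unit_cube)"

text \<open>The predicate and the length are parameters so that a single Mecke formula serves both
  moments: \<open>geo_iso\<close> with length \<open>k\<close> for the mean, \<open>far_pair\<close>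
  with length \<open>2 * k\<close> for pairs of components.\<close>

definition ctuples :: "real \<Rightarrow> nat \<Rightarrow> ((nat \<Rightarrow> real^'d) \<Rightarrow> bool) \<Rightarrow> (real^'d) set \<Rightarrow> (nat \<Rightarrow> real^'d) set" where
  "ctuples r m P X = {t \<in> {..<m} \<rightarrow>\<^sub>E X. inj_on t {..<m} \<and> P t \<and> (X - t ` {..<m}) \<inter> cover r m t = {}}"

lemma Jcomp_ctuples: "Jcomp r k G X = card (ctuples r k (geo_iso r k G) X) / fact k"
proof -
  have "{x \<in> {..<k} \<rightarrow>\<^sub>E X. inj_on x {..<k} \<and> geo_iso r k G x \<and>
        (\<forall>y \<in> X - x ` {..<k}. \<forall>i<k. tdist (x i) y > r)} = ctuples r k (geo_iso r k G) X"
    unfolding ctuples_def cover_def by (rule Collect_cong) (auto simp: disjoint_iff not_le[symmetric])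
  then show ?thesis by (simp add: Jcomp_def)
qed

lemma finite_ctuples: "finite X \<Longrightarrow> finite (ctuples r m P X)"
  unfolding ctuples_def by (rule finite_subset[OF _ finite_PiE[of "{..<m}" "\<lambda>_. X"]]) auto

lemma card_ctuples_le: "finite X \<Longrightarrow> card (ctuples r m P X) \<le> card X ^ m"
  using card_mono[OF finite_PiE[of "{..<m}" "\<lambda>_. X"], of "ctuples r m P X"]
  by (auto simp: ctuples_def card_PiE)

lemma cover_restrict [simp]: "cover r m (restrict t {..<m}) = cover r m t"
  by (auto simp: cover_def)

lemma cvol_restrict [simp]: "cvol r m (restrict t {..<m}) = cvol r m t"
  by (simp add: cvol_def)

lemma cover_borel [measurable]: "cover r m t \<in> sets borel"
  unfolding cover_def by measurable

lemma cvol_measurable [measurable]: "cvol r m \<in> borel_measurable (tpow m)"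
proof -
  have "(\<lambda>t. emeasure torus_meas (cover r m t \<inter> unit_cube)) \<in> borel_measurable (tpow m)"
  proof (rule torus.measurable_emeasure)
    have [measurable]: "(\<lambda>p. fst p i) \<in> tpow m \<Otimes>\<^sub>M torus_meas \<rightarrow>\<^sub>M borel" if "i \<in> {..<m}" for i
      using that by (intro measurable_compose[OF measurable_fst measurable_tpow_component])
    have [measurable]: "snd \<in> tpow m \<Otimes>\<^sub>M (torus_meas :: (real^'d) measure) \<rightarrow>\<^sub>M borel"
      by (intro measurable_torus_borel measurable_snd)
    have "{p \<in> space (tpow m \<Otimes>\<^sub>M torus_meas). \<exists>i\<in>{..<m}. tdist (fst p i) (snd p) \<le> r} \<in> sets (tpow m \<Otimes>\<^sub>M torus_meas)"
      by measurable
    also have "{p \<in> space (tpow m \<Otimes>\<^sub>M torus_meas). \<exists>i\<in>{..<m}. tdist (fst p i) (snd p) \<le> r}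
       = {p \<in> space (tpow m \<Otimes>\<^sub>M torus_meas). snd p \<in> cover r m (fst p) \<inter> unit_cube}"
      by (auto simp: space_pair_measure cover_def)
    finally show "{p \<in> space (tpow m \<Otimes>\<^sub>M torus_meas). snd p \<in> cover r m (fst p) \<inter> unit_cube} \<in> sets (tpow m \<Otimes>\<^sub>M torus_meas)" .
  qed auto
  then have "(\<lambda>t. enn2real (emeasure torus_meas (cover r m t \<inter> unit_cube))) \<in> borel_measurable (tpow m)"
    by (rule borel_measurable_enn2real)
  then show ?thesis by (simp add: cvol_def[abs_def] measure_def)
qed

lemma cvol_bounds: "0 \<le> cvol r m t" "cvol r m t \<le> 1"
  by (auto simp: cvol_def)

text \<open>Summing over index maps that are least in their fibre gives a formula, valid also for
  configurations with repeated points, from which measurability is evident.\<close>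

lemma card_ctuples_sum:
  fixes n :: nat
  shows "card (ctuples r m P (x ` {..<n})) =
    (\<Sum>\<phi>\<in>{..<m} \<rightarrow>\<^sub>E {..<n}. of_bool ((\<forall>i<m. \<forall>j<\<phi> i. x j \<noteq> x (\<phi> i)) \<and>
       restrict (x \<circ> \<phi>) {..<m} \<in> ctuples r m P (x ` {..<n})))"
proof -
  let ?A = "{\<phi>\<in>{..<m} \<rightarrow>\<^sub>E {..<n}. (\<forall>i<m. \<forall>j<\<phi> i. x j \<noteq> x (\<phi> i)) \<and>
       restrict (x \<circ> \<phi>) {..<m} \<in> ctuples r m P (x ` {..<n})}"
  have fin: "finite ({..<m} \<rightarrow>\<^sub>E {..<n})" by (simp add: finite_PiE)
  have "bij_betw (\<lambda>\<phi>. restrict (x \<circ> \<phi>) {..<m}) ?A (ctuples r m P (x ` {..<n}))"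
  proof (rule bij_betw_imageI)
    show "inj_on (\<lambda>\<phi>. restrict (x \<circ> \<phi>) {..<m}) ?A"
    proof (rule inj_onI)
      fix \<phi> \<psi> assume \<phi>: "\<phi> \<in> ?A" and \<psi>: "\<psi> \<in> ?A"
        and eq: "restrict (x \<circ> \<phi>) {..<m} = restrict (x \<circ> \<psi>) {..<m}"
      have "\<phi> i = \<psi> i" if "i < m" for i
      proof -
        have "x (\<phi> i) = x (\<psi> i)" using fun_cong[OF eq, of i] that by simp
        then show ?thesis using \<phi> \<psi> that by (metis (mono_tags, lifting) linorder_neqE_nat mem_Collect_eq)
      qed
      then show "\<phi> = \<psi>" using \<phi> \<psi> by (intro PiE_ext[of \<phi> "{..<m}" "\<lambda>_. {..<n}"]) auto
    qed
    show "(\<lambda>\<phi>. restrict (x \<circ> \<phi>) {..<m}) ` ?A = ctuples r m P (x ` {..<n})"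
    proof (intro equalityI subsetI)
      fix t assume t: "t \<in> ctuples r m P (x ` {..<n})"
      define \<phi> where "\<phi> = restrict (\<lambda>i. LEAST j. x j = t i) {..<m}"
      have ex: "\<exists>j<n. x j = t i" if "i < m" for i
        using t that by (fastforce simp: ctuples_def PiE_def Pi_def image_iff)
      have L: "\<phi> i < n" "x (\<phi> i) = t i" "\<forall>j<\<phi> i. x j \<noteq> t i" if "i < m" for i
      proof -
        obtain j where j: "j < n" "x j = t i" using ex[OF \<open>i < m\<close>] by blast
        have \<phi>i: "\<phi> i = (LEAST j. x j = t i)" using \<open>i < m\<close> by (simp add: \<phi>_def)
        have "\<phi> i \<le> j" unfolding \<phi>i by (rule Least_le) (rule j)
        then show "\<phi> i < n" using j by simp
        show "x (\<phi> i) = t i" unfolding \<phi>i by (rule LeastI[of _ j]) (rule j)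
        show "\<forall>j<\<phi> i. x j \<noteq> t i" unfolding \<phi>i by (auto dest: not_less_Least)
      qed
      have te: "t = restrict (x \<circ> \<phi>) {..<m}"
        using t L(2) by (auto simp: ctuples_def PiE_def extensional_def fun_eq_iff restrict_def)
      have "\<phi> \<in> {..<m} \<rightarrow>\<^sub>E {..<n}"
        by (rule PiE_I) (use L(1) in \<open>auto simp: \<phi>_def\<close>)
      moreover have "\<forall>i<m. \<forall>j<\<phi> i. x j \<noteq> x (\<phi> i)" using L(2,3) by metis
      ultimately have "\<phi> \<in> ?A" using t te by simp
      then show "t \<in> (\<lambda>\<phi>. restrict (x \<circ> \<phi>) {..<m}) ` ?A" using te by blast
    qed auto
  qed
  then have "card (ctuples r m P (x ` {..<n})) = card ?A" by (rule bij_betw_same_card[symmetric])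
  also have "\<dots> = (\<Sum>\<phi>\<in>{..<m} \<rightarrow>\<^sub>E {..<n}. of_bool ((\<forall>i<m. \<forall>j<\<phi> i. x j \<noteq> x (\<phi> i)) \<and>
       restrict (x \<circ> \<phi>) {..<m} \<in> ctuples r m P (x ` {..<n})))"
    using fin by (simp add: sum_of_bool_eq Int_def)
  finally show ?thesis .
qed

lemma measurable_reindex:
  assumes "\<phi> ` {..<m} \<subseteq> I"
  shows "(\<lambda>x. restrict (x \<circ> \<phi>) {..<m}) \<in> PiM I (\<lambda>_. torus_meas :: (real^'d) measure) \<rightarrow>\<^sub>M tpow m"
proof -
  have "(\<lambda>x. \<lambda>i\<in>{..<m}. x (\<phi> i)) \<in> PiM I (\<lambda>_. torus_meas :: (real^'d) measure) \<rightarrow>\<^sub>M tpow m"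
    using assms by (intro measurable_restrict measurable_component_singleton) auto
  then show ?thesis by (simp add: comp_def)
qed

text \<open>Apart from \<open>P\<close>, the right-hand side is a finite Boolean combination of
  equalities and distance comparisons between coordinates, hence visibly measurable. Points rather
  than indices are compared because \<open>x\<close> may repeat values.\<close>

lemma restrict_in_ctuples_iff:
  fixes n :: nat
  assumes "\<phi> \<in> {..<m} \<rightarrow>\<^sub>E {..<n}"
  shows "restrict (x \<circ> \<phi>) {..<m} \<in> ctuples r m P (x ` {..<n}) \<longleftrightarrow>
    (\<forall>i<m. \<forall>j<m. i \<noteq> j \<longrightarrow> x (\<phi> i) \<noteq> x (\<phi> j)) \<and> P (restrict (x \<circ> \<phi>) {..<m}) \<and>
    (\<forall>j<n. (\<exists>i<m. x j = x (\<phi> i)) \<or> (\<forall>i<m. \<not> tdist (x (\<phi> i)) (x j) \<le> r))"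
proof -
  have 1: "restrict (x \<circ> \<phi>) {..<m} \<in> {..<m} \<rightarrow>\<^sub>E x ` {..<n}" using assms by auto
  have 2: "inj_on (restrict (x \<circ> \<phi>) {..<m}) {..<m} \<longleftrightarrow> (\<forall>i<m. \<forall>j<m. i \<noteq> j \<longrightarrow> x (\<phi> i) \<noteq> x (\<phi> j))"
    by (auto simp: inj_on_def)
  have 3: "restrict (x \<circ> \<phi>) {..<m} ` {..<m} = {y. \<exists>i<m. y = x (\<phi> i)}" by (auto simp: image_iff)
  have 4: "(x ` {..<n} - {y. \<exists>i<m. y = x (\<phi> i)}) \<inter> cover r m (x \<circ> \<phi>) = {} \<longleftrightarrow>
      (\<forall>j<n. (\<exists>i<m. x j = x (\<phi> i)) \<or> (\<forall>i<m. \<not> tdist (x (\<phi> i)) (x j) \<le> r))"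
    by (auto simp: cover_def disjoint_iff)
  show ?thesis unfolding ctuples_def mem_Collect_eq 2 3 cover_restrict 4 using 1 by blast
qed

lemma measurable_card_ctuples:
  fixes P :: "(nat \<Rightarrow> real^'d) \<Rightarrow> bool"
  assumes P [measurable]: "Measurable.pred (tpow m) P"
  shows "(\<lambda>x. real (card (ctuples r m P (x ` {..<n})))) \<in> borel_measurable (tpow n)"
proof -
  have "Measurable.pred (tpow n) (\<lambda>x. (\<forall>i<m. \<forall>j<\<phi> i. x j \<noteq> x (\<phi> i)) \<and>
       restrict (x \<circ> \<phi>) {..<m} \<in> ctuples r m P (x ` {..<n}))" (is "Measurable.pred _ ?Q")
    if \<phi>: "\<phi> \<in> {..<m} \<rightarrow>\<^sub>E {..<n}" for \<phi>
  proof -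
    have \<phi>n: "\<phi> i < n" if "i < m" for i using \<phi> that by auto
    have [measurable]: "(\<lambda>x. restrict (x \<circ> \<phi>) {..<m}) \<in> tpow n \<rightarrow>\<^sub>M tpow m"
      using \<phi> by (intro measurable_reindex) auto
    have Q: "?Q = (\<lambda>x. (\<forall>i\<in>{..<m}. \<forall>j\<in>{..<n}. j < \<phi> i \<longrightarrow> x j \<noteq> x (\<phi> i)) \<and>
        (\<forall>i\<in>{..<m}. \<forall>j\<in>{..<m}. i \<noteq> j \<longrightarrow> x (\<phi> i) \<noteq> x (\<phi> j)) \<and>
        P (restrict (x \<circ> \<phi>) {..<m}) \<and>
        (\<forall>j\<in>{..<n}. (\<exists>i\<in>{..<m}. x j = x (\<phi> i)) \<or> (\<forall>i\<in>{..<m}. \<not> tdist (x (\<phi> i)) (x j) \<le> r)))"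
        (is "_ = ?R")
    proof (intro ext)
      fix x :: "nat \<Rightarrow> real^'d"
      have "(\<forall>i<m. \<forall>j<\<phi> i. x j \<noteq> x (\<phi> i)) \<longleftrightarrow> (\<forall>i\<in>{..<m}. \<forall>j\<in>{..<n}. j < \<phi> i \<longrightarrow> x j \<noteq> x (\<phi> i))"
        using \<phi>n by (meson lessThan_iff order.strict_trans)
      then show "?Q x = (?R x)"
        unfolding restrict_in_ctuples_iff[OF \<phi>] by (simp only: Ball_def lessThan_iff Bex_def)
    qed
    have x1: "(\<lambda>x. x j) \<in> tpow n \<rightarrow>\<^sub>M borel" if "j \<in> {..<n}" for j
      using that by (rule measurable_tpow_component)
    have x2: "(\<lambda>x. x (\<phi> i)) \<in> tpow n \<rightarrow>\<^sub>M borel" if "i \<in> {..<m}" for i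
      using that \<phi>n by (intro measurable_tpow_component) auto
    have "Measurable.pred (tpow n) (\<lambda>x. tdist (x (\<phi> i)) (x j) \<le> r)" if "i \<in> {..<m}" "j \<in> {..<n}" for i j
      unfolding pred_def by (rule borel_measurable_le[OF borel_measurable_tdist[OF x2[OF that(1)] x1[OF that(2)]] borel_measurable_const])
    moreover have "Measurable.pred (tpow n) (\<lambda>x. P (restrict (x \<circ> \<phi>) {..<m}))"
      by measurable
    ultimately show ?thesis unfolding Q
      by (intro pred_intros_logic pred_intros_finite finite_lessThan measurable_vec_eq x1 x2)
        (use \<phi>n in auto)
  qed
  then have *: "(\<lambda>x. of_bool ((\<forall>i<m. \<forall>j<\<phi> i. x j \<noteq> x (\<phi> i)) \<and>
       restrict (x \<circ> \<phi>) {..<m} \<in> ctuples r m P (x ` {..<n})) :: real) \<in> borel_measurable (tpow n)"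
    if \<phi>: "\<phi> \<in> {..<m} \<rightarrow>\<^sub>E {..<n}" for \<phi>
    using that by (intro measurable_compose[OF _ measurable_of_bool])
  have "(\<lambda>x. \<Sum>\<phi>\<in>{..<m} \<rightarrow>\<^sub>E {..<n}. of_bool ((\<forall>i<m. \<forall>j<\<phi> i. x j \<noteq> x (\<phi> i)) \<and>
       restrict (x \<circ> \<phi>) {..<m} \<in> ctuples r m P (x ` {..<n})) :: real) \<in> borel_measurable (tpow n)"
    by (intro borel_measurable_sum *)
  then show ?thesis unfolding card_ctuples_sum by (simp only: of_nat_sum of_nat_of_bool)
qed

text \<open>With all coordinates but the \<open>i\<close>-th fixed, coincidence with the
  \<open>j\<close>-th confines the \<open>i\<close>-th to a single point, which is a null
  set.\<close>

lemma AE_tpow_inj: "AE x in tpow n. inj_on x {..<n}"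
proof -
  have "AE x in tpow n. x i \<noteq> (x j :: real^'d)" if ij: "i < n" "j < n" "i \<noteq> j" for i j
  proof (rule AE_I)
    define K where "K = {..<n} - {i}"
    have K: "{..<n} = insert i K" "i \<notin> K" "finite K" "j \<in> K" using ij by (auto simp: K_def)
    let ?A = "{x \<in> space (tpow n). x i = (x j :: real^'d)}"
    show "{x \<in> space (tpow n). \<not> x i \<noteq> (x j :: real^'d)} \<subseteq> ?A" by auto
    have "(\<lambda>x. x i) \<in> tpow n \<rightarrow>\<^sub>M borel" "(\<lambda>x. x j) \<in> tpow n \<rightarrow>\<^sub>M borel"
      using ij by (auto intro: measurable_tpow_component)
    show A: "?A \<in> sets (tpow n)" by (rule measurable_equality_set) fact+
    have "emeasure (tpow n) ?A = (\<integral>\<^sup>+x. indicator ?A x \<partial>tpow n)"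
      by (rule nn_integral_indicator[OF A, symmetric])
    also have "\<dots> = (\<integral>\<^sup>+x. \<integral>\<^sup>+y. indicator ?A (x(i := y)) \<partial>torus_meas \<partial>PiM K (\<lambda>_. torus_meas))"
      unfolding K(1)
      by (rule tprod.product_nn_integral_insert[OF K(3,2) borel_measurable_indicator[OF A[unfolded K(1)]]])
    also have "\<dots> = (\<integral>\<^sup>+x. 0 \<partial>PiM K (\<lambda>_. torus_meas :: (real^'d) measure))"
    proof (rule nn_integral_cong)
      fix x :: "nat \<Rightarrow> real^'d" assume x: "x \<in> space (PiM K (\<lambda>_. torus_meas))"
      have xj: "x j \<in> unit_cube" using x K(4) by (auto simp: space_PiM)
      have "(\<integral>\<^sup>+y. indicator ?A (x(i := y)) \<partial>torus_meas) \<le> (\<integral>\<^sup>+y. indicator {x j} y \<partial>torus_meas)"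
        using ij by (intro nn_integral_mono) (auto split: split_indicator)
      also have "\<dots> = emeasure torus_meas {x j}"
        using sets_torus_Int[of "{x j}"] xj by (intro nn_integral_indicator) auto
      finally show "(\<integral>\<^sup>+y. indicator ?A (x(i := y)) \<partial>torus_meas) = 0"
        by (simp add: emeasure_torus_singleton)
    qed
    finally show "emeasure (tpow n) ?A = 0" by simp
  qed
  then have "AE x in tpow n. \<forall>i\<in>{..<n}. \<forall>j\<in>{..<n}. i \<noteq> j \<longrightarrow> x i \<noteq> (x j :: real^'d)"
    by (intro AE_finite_allI) auto
  then show ?thesis by eventually_elim (auto simp: inj_on_def)
qed

subsection \<open>The Mecke formula for isolated tuples\<close>

lemma restrict_in_ctuples_iff_inj:
  fixes n :: nat
  assumes \<phi>: "\<phi> \<in> {..<m} \<rightarrow>\<^sub>E {..<n}" and x: "inj_on x {..<n}"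
  shows "restrict (x \<circ> \<phi>) {..<m} \<in> ctuples r m P (x ` {..<n}) \<longleftrightarrow>
    inj_on \<phi> {..<m} \<and> P (restrict (x \<circ> \<phi>) {..<m}) \<and>
    (\<forall>j\<in>{..<n} - \<phi> ` {..<m}. x j \<notin> cover r m (x \<circ> \<phi>))"
proof -
  have \<phi>n: "\<phi> i < n" if "i < m" for i using \<phi> that by auto
  have xeq: "x i = x j \<longleftrightarrow> i = j" if "i < n" "j < n" for i j
    using x that by (auto simp: inj_on_def)
  have 1: "(\<forall>i<m. \<forall>j<m. i \<noteq> j \<longrightarrow> x (\<phi> i) \<noteq> x (\<phi> j)) \<longleftrightarrow> inj_on \<phi> {..<m}"
    using \<phi>n xeq by (auto simp: inj_on_def)
  have 2: "(\<exists>i<m. x j = x (\<phi> i)) \<longleftrightarrow> j \<in> \<phi> ` {..<m}" if "j < n" for j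
    using \<phi>n xeq that by auto
  have 3: "(\<forall>i<m. \<not> tdist (x (\<phi> i)) (x j) \<le> r) \<longleftrightarrow> x j \<notin> cover r m (x \<circ> \<phi>)" for j
    by (auto simp: cover_def)
  show ?thesis unfolding restrict_in_ctuples_iff[OF \<phi>] 1 3 using 2 by auto
qed

text \<open>For distinct points the isolation condition becomes a product over the unchosen indices,
  so those coordinates can be integrated out independently of each other.\<close>

lemma card_ctuples_sum_inj:
  fixes n :: nat
  assumes x: "inj_on x {..<n}"
  shows "real (card (ctuples r m P (x ` {..<n}))) =
    (\<Sum>\<phi>\<in>{\<phi>\<in>{..<m} \<rightarrow>\<^sub>E {..<n}. inj_on \<phi> {..<m}}. of_bool (P (restrict (x \<circ> \<phi>) {..<m})) *
       (\<Prod>j\<in>{..<n} - \<phi> ` {..<m}. of_bool (x j \<notin> cover r m (x \<circ> \<phi>))))"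
proof -
  have "real (card (ctuples r m P (x ` {..<n}))) = (\<Sum>\<phi>\<in>{..<m} \<rightarrow>\<^sub>E {..<n}. of_bool ((\<forall>i<m. \<forall>j<\<phi> i. x j \<noteq> x (\<phi> i)) \<and>
       restrict (x \<circ> \<phi>) {..<m} \<in> ctuples r m P (x ` {..<n})))"
    unfolding card_ctuples_sum by simp
  also have "\<dots> = (\<Sum>\<phi>\<in>{..<m} \<rightarrow>\<^sub>E {..<n}. if inj_on \<phi> {..<m} then of_bool (P (restrict (x \<circ> \<phi>) {..<m})) *
       (\<Prod>j\<in>{..<n} - \<phi> ` {..<m}. of_bool (x j \<notin> cover r m (x \<circ> \<phi>))) else 0)"
  proof (rule sum.cong[OF refl])
    fix \<phi> assume \<phi>: "\<phi> \<in> {..<m} \<rightarrow>\<^sub>E {..<n}"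
    have \<phi>n: "\<phi> i < n" if "i < m" for i using \<phi> that by auto
    \<comment> \<open>For injective \<open>x\<close> every fibre is a singleton, so the minimality
      condition on \<open>\<phi>\<close> holds automatically.\<close>
    have 1: "\<forall>i<m. \<forall>j<\<phi> i. x j \<noteq> x (\<phi> i)"
    proof (intro allI impI)
      fix i j assume "i < m" "j < \<phi> i"
      then show "x j \<noteq> x (\<phi> i)" using inj_onD[OF x, of j "\<phi> i"] \<phi>n[of i] by force
    qed
    have 2: "(\<Prod>j\<in>{..<n} - \<phi> ` {..<m}. of_bool (x j \<notin> cover r m (x \<circ> \<phi>)))
        = (of_bool (\<forall>j\<in>{..<n} - \<phi> ` {..<m}. x j \<notin> cover r m (x \<circ> \<phi>)) :: real)"
      by (simp add: of_bool_def prod_zero_iff)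
    show "of_bool ((\<forall>i<m. \<forall>j<\<phi> i. x j \<noteq> x (\<phi> i)) \<and> restrict (x \<circ> \<phi>) {..<m} \<in> ctuples r m P (x ` {..<n}))
      = (if inj_on \<phi> {..<m} then of_bool (P (restrict (x \<circ> \<phi>) {..<m})) *
       (\<Prod>j\<in>{..<n} - \<phi> ` {..<m}. of_bool (x j \<notin> cover r m (x \<circ> \<phi>))) else (0::real))"
      unfolding restrict_in_ctuples_iff_inj[OF \<phi> x] 2 using 1 by (simp add: of_bool_def)
  qed
  also have "\<dots> = (\<Sum>\<phi>\<in>{\<phi>\<in>{..<m} \<rightarrow>\<^sub>E {..<n}. inj_on \<phi> {..<m}}. of_bool (P (restrict (x \<circ> \<phi>) {..<m})) *
       (\<Prod>j\<in>{..<n} - \<phi> ` {..<m}. of_bool (x j \<notin> cover r m (x \<circ> \<phi>))))"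
    by (subst sum.inter_filter) (auto intro: finite_PiE)
  finally show ?thesis .
qed

lemma integrable_tpow_bounded:
  fixes f :: "(nat \<Rightarrow> real^'d) \<Rightarrow> real"
  assumes "f \<in> borel_measurable (PiM I (\<lambda>_. torus_meas))"
    and "\<And>x. x \<in> space (PiM I (\<lambda>_. torus_meas)) \<Longrightarrow> \<bar>f x\<bar> \<le> B"
  shows "integrable (PiM I (\<lambda>_. torus_meas)) f"
proof -
  interpret prob_space "PiM I (\<lambda>_. torus_meas :: (real^'d) measure)" by (rule prob_space_tpow)
  show ?thesis using assms by (intro integrable_const_bound[where B = B] AE_I2) auto
qed

lemma integral_tpow_reindex:
  fixes F :: "(nat \<Rightarrow> real^'d) \<Rightarrow> real"
  assumes "inj_on \<phi> {..<m}" "\<phi> ` {..<m} \<subseteq> I" and F [measurable]: "F \<in> borel_measurable (tpow m)"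
  shows "(\<integral>x. F (restrict (x \<circ> \<phi>) {..<m}) \<partial>PiM I (\<lambda>_. torus_meas)) = (\<integral>z. F z \<partial>tpow m)"
proof -
  have "distr (PiM I (\<lambda>_. torus_meas :: (real^'d) measure)) (tpow m) (\<lambda>x. restrict (x \<circ> \<phi>) {..<m}) = tpow m"
    using distr_PiM_reindex[of I "\<lambda>_. torus_meas :: (real^'d) measure" \<phi> "{..<m}"] assms prob_space_torus_meas
    by (auto simp: comp_def image_subset_iff Pi_iff)
  then have "(\<integral>z. F z \<partial>tpow m) = (\<integral>z. F z \<partial>distr (PiM I (\<lambda>_. torus_meas)) (tpow m) (\<lambda>x. restrict (x \<circ> \<phi>) {..<m}))"
    by simp
  also have "\<dots> = (\<integral>x. F (restrict (x \<circ> \<phi>) {..<m}) \<partial>PiM I (\<lambda>_. torus_meas))"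
    using measurable_reindex[OF assms(2)] by (intro integral_distr F)
  finally show ?thesis by simp
qed

lemma measurable_notin_cover:
  assumes [measurable]: "\<And>i. i < m \<Longrightarrow> (\<lambda>w. t w i) \<in> borel_measurable N" "y \<in> borel_measurable N"
  shows "Measurable.pred N (\<lambda>w. y w \<notin> cover r m (t w))"
proof -
  have [measurable]: "(\<lambda>w. t w i) \<in> borel_measurable N" if "i \<in> {..<m}" for i using that by simp
  have "(\<lambda>w. y w \<notin> cover r m (t w)) = (\<lambda>w. \<forall>i\<in>{..<m}. \<not> tdist (t w i) (y w) \<le> r)"
    by (auto simp: cover_def)
  then show ?thesis by simp
qed

lemma integral_notin_cover:
  "(\<integral>y. of_bool (y \<notin> cover r m t) \<partial>torus_meas) = 1 - cvol r m t"
proof -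
  have "(\<integral>y. of_bool (y \<notin> cover r m t) \<partial>torus_meas) = (\<integral>y. indicator (space torus_meas - cover r m t \<inter> unit_cube) y \<partial>torus_meas)"
    by (intro Bochner_Integration.integral_cong) (auto simp: of_bool_def split: split_indicator)
  also have "\<dots> = torus.prob (space torus_meas - cover r m t \<inter> unit_cube)"
    using sets_torus_Int[OF cover_borel] by (simp add: Int_absorb2 Diff_subset)
  also have "\<dots> = 1 - cvol r m t"
    using sets_torus_Int[OF cover_borel] unfolding cvol_def by (rule torus.prob_compl)
  finally show ?thesis .
qed

text \<open>Given the chosen coordinates, each of the \<open>n - m\<close> remaining points
  independently avoids their neighbourhood with probability \<open>1 - cvol\<close>. The integral
  then depends on \<open>\<phi>\<close> no longer, since the coordinates are identically
  distributed.\<close>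

lemma integral_isolated:
  fixes P :: "(nat \<Rightarrow> real^'d) \<Rightarrow> bool" and n :: nat and r :: real
  assumes P [measurable]: "Measurable.pred (tpow m) P"
    and \<phi>: "\<phi> \<in> {..<m} \<rightarrow>\<^sub>E {..<n}" and inj: "inj_on \<phi> {..<m}"
  defines "H \<equiv> \<lambda>x. of_bool (P (restrict (x \<circ> \<phi>) {..<m})) *
       (\<Prod>j\<in>{..<n} - \<phi> ` {..<m}. of_bool (x j \<notin> cover r m (x \<circ> \<phi>))) :: real"
  shows "integrable (tpow n) H"
    and "(\<integral>x. H x \<partial>tpow n) = (\<integral>z. of_bool (P z) * (1 - cvol r m z) ^ (n - m) \<partial>tpow m)"
proof -
  define I J where "I = \<phi> ` {..<m}" and "J = {..<n} - I"
  have IJ: "I \<inter> J = {}" "I \<union> J = {..<n}" "finite I" "finite J"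
    using \<phi> by (auto simp: I_def J_def)
  have cI: "card I = m" using inj by (simp add: I_def card_image)
  have cJ: "card J = n - m"
    using IJ cI by (metis card_Un_disjoint card_lessThan diff_add_inverse)
  have \<phi>n: "\<phi> i < n" if "i < m" for i using \<phi> that by auto
  have [measurable]: "(\<lambda>x. restrict (x \<circ> \<phi>) {..<m}) \<in> tpow n \<rightarrow>\<^sub>M tpow m"
    using \<phi>n by (intro measurable_reindex) auto
  have [measurable]: "(\<lambda>x. restrict (x \<circ> \<phi>) {..<m}) \<in> PiM I (\<lambda>_. torus_meas) \<rightarrow>\<^sub>M tpow m"
    by (intro measurable_reindex) (auto simp: I_def)
  have H: "H = (\<lambda>x. of_bool (P (restrict (x \<circ> \<phi>) {..<m})) * (\<Prod>j\<in>J. of_bool (x j \<notin> cover r m (x \<circ> \<phi>))))"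
    by (simp add: H_def J_def I_def)
  have Hb: "\<bar>H x\<bar> \<le> 1" for x
  proof -
    have "\<bar>\<Prod>j\<in>J. of_bool (x j \<notin> cover r m (x \<circ> \<phi>)) :: real\<bar> \<le> 1"
      unfolding abs_prod by (rule prod_le_1) auto
    then show ?thesis unfolding H by (auto simp: of_bool_def)
  qed
  have [measurable]: "Measurable.pred (tpow n) (\<lambda>x. x j \<notin> cover r m (x \<circ> \<phi>))" if "j \<in> J" for j
    using \<phi>n that by (intro measurable_notin_cover) (auto simp: J_def intro: measurable_tpow_component)
  have Hm [measurable]: "H \<in> borel_measurable (tpow n)" unfolding H by measurable
  show int: "integrable (tpow n) H" using Hm Hb by (intro integrable_tpow_bounded)
  have "(\<integral>x. H x \<partial>tpow n) = (\<integral>x. \<integral>y. H (merge I J (x, y)) \<partial>PiM J (\<lambda>_. torus_meas) \<partial>PiM I (\<lambda>_. torus_meas))"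
    unfolding IJ(2)[symmetric] by (rule tprod.product_integral_fold[OF IJ(1,3,4)]) (simp add: IJ(2) int)
  also have "\<dots> = (\<integral>x. of_bool (P (restrict (x \<circ> \<phi>) {..<m})) * (1 - cvol r m (restrict (x \<circ> \<phi>) {..<m})) ^ (n - m) \<partial>PiM I (\<lambda>_. torus_meas))"
  proof (rule Bochner_Integration.integral_cong[OF refl])
    fix x :: "nat \<Rightarrow> real^'d"
    have m1: "merge I J (x, y) (\<phi> i) = x (\<phi> i)" if "i < m" for i y
      using that by (auto simp: merge_def I_def)
    have m2: "restrict (merge I J (x, y) \<circ> \<phi>) {..<m} = restrict (x \<circ> \<phi>) {..<m}" for y
      using m1 by (auto simp: restrict_def)
    have m3: "cover r m (merge I J (x, y) \<circ> \<phi>) = cover r m (x \<circ> \<phi>)" for y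
      using m1 by (auto simp: cover_def)
    have m4: "merge I J (x, y) j = y j" if "j \<in> J" for y j
      using that by (auto simp: merge_def J_def)
    have "(\<integral>y. H (merge I J (x, y)) \<partial>PiM J (\<lambda>_. torus_meas)) =
      (\<integral>y. of_bool (P (restrict (x \<circ> \<phi>) {..<m})) * (\<Prod>j\<in>J. of_bool (y j \<notin> cover r m (x \<circ> \<phi>))) \<partial>PiM J (\<lambda>_. torus_meas))"
      unfolding H m2 m3 by (simp add: m4 cong: prod.cong)
    also have "\<dots> = of_bool (P (restrict (x \<circ> \<phi>) {..<m})) * (\<integral>y. (\<Prod>j\<in>J. of_bool (y j \<notin> cover r m (x \<circ> \<phi>))) \<partial>PiM J (\<lambda>_. torus_meas))"
      by simp
    also have "(\<integral>y. (\<Prod>j\<in>J. of_bool (y j \<notin> cover r m (x \<circ> \<phi>))) \<partial>PiM J (\<lambda>_. torus_meas))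
       = (\<Prod>j\<in>J. \<integral>y. (of_bool (y \<notin> cover r m (x \<circ> \<phi>)) :: real) \<partial>torus_meas)"
    proof (rule tprod.product_integral_prod[OF IJ(4)])
      have [measurable]: "Measurable.pred torus_meas (\<lambda>y. y \<notin> cover r m (x \<circ> \<phi>))"
        by (intro measurable_notin_cover) (auto intro: measurable_id_torus)
      show "integrable torus_meas (\<lambda>y. of_bool (y \<notin> cover r m (x \<circ> \<phi>)) :: real)"
        by (rule torus.integrable_const_bound[where B = 1]) auto
    qed
    also have "\<dots> = (1 - cvol r m (restrict (x \<circ> \<phi>) {..<m})) ^ (n - m)"
      by (simp add: integral_notin_cover cJ)
    finally show "(\<integral>y. H (merge I J (x, y)) \<partial>PiM J (\<lambda>_. torus_meas)) =
      of_bool (P (restrict (x \<circ> \<phi>) {..<m})) * (1 - cvol r m (restrict (x \<circ> \<phi>) {..<m})) ^ (n - m)" .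
  qed
  also have "\<dots> = (\<integral>z. of_bool (P z) * (1 - cvol r m z) ^ (n - m) \<partial>tpow m)"
    by (rule integral_tpow_reindex[OF inj, of I "\<lambda>z. of_bool (P z) * (1 - cvol r m z) ^ (n - m)"]) (auto simp: I_def)
  finally show "(\<integral>x. H x \<partial>tpow n) = (\<integral>z. of_bool (P z) * (1 - cvol r m z) ^ (n - m) \<partial>tpow m)" .
qed

lemma card_inj_PiE:
  fixes m n :: nat
  shows "real (card {\<phi>\<in>{..<m} \<rightarrow>\<^sub>E {..<n}. inj_on \<phi> {..<m}}) = (if m \<le> n then fact n / fact (n - m) else 0)"
proof -
  have card: "card {\<phi>\<in>{..<m} \<rightarrow>\<^sub>E {..<n}. inj_on \<phi> {..<m}} = prod ((-) n) {0..<m}"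
    by (subst card_inj_on_subset_funcset) (auto simp: atLeast0LessThan)
  have "real (prod ((-) n) {0..<m}) * fact (n - m) = fact n" if "m \<le> n"
    using that
  proof (induction m)
    case (Suc m)
    then have "fact (n - m) = real (n - m) * fact (n - Suc m)"
      by (metis Suc_diff_Suc Suc_le_lessD fact_Suc of_nat_mult of_nat_fact)
    then show ?case using Suc by (simp add: mult.assoc)
  qed simp
  moreover have "prod ((-) n) {0..<m} = 0" if "\<not> m \<le> n"
    using that by (intro prod_zero) (auto intro!: bexI[of _ n])
  ultimately show ?thesis unfolding card by (auto simp: field_simps)
qed

lemma integral_card_ctuples:
  fixes P :: "(nat \<Rightarrow> real^'d) \<Rightarrow> bool" and n :: nat
  assumes P [measurable]: "Measurable.pred (tpow m) P"
  shows "(\<integral>x. real (card (ctuples r m P (x ` {..<n}))) \<partial>tpow n) =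
    (if m \<le> n then fact n / fact (n - m) else 0) * (\<integral>z. of_bool (P z) * (1 - cvol r m z) ^ (n - m) \<partial>tpow m)"
proof -
  let ?I = "{\<phi>\<in>{..<m} \<rightarrow>\<^sub>E {..<n}. inj_on \<phi> {..<m}}"
  let ?H = "\<lambda>\<phi> x. of_bool (P (restrict (x \<circ> \<phi>) {..<m})) *
       (\<Prod>j\<in>{..<n} - \<phi> ` {..<m}. of_bool (x j \<notin> cover r m (x \<circ> \<phi>))) :: real"
  have "(\<integral>x. real (card (ctuples r m P (x ` {..<n}))) \<partial>tpow n) = (\<integral>x. (\<Sum>\<phi>\<in>?I. ?H \<phi> x) \<partial>tpow n)"
  proof (rule integral_cong_AE)
    show "AE x in tpow n. real (card (ctuples r m P (x ` {..<n}))) = (\<Sum>\<phi>\<in>?I. ?H \<phi> x)"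
      using AE_tpow_inj by eventually_elim (rule card_ctuples_sum_inj)
    show "(\<lambda>x. \<Sum>\<phi>\<in>?I. ?H \<phi> x) \<in> borel_measurable (tpow n)"
      using integral_isolated(1)[OF P] by (intro borel_measurable_sum borel_measurable_integrable) auto
  qed (rule measurable_card_ctuples[OF P])
  also have "\<dots> = (\<Sum>\<phi>\<in>?I. \<integral>x. ?H \<phi> x \<partial>tpow n)"
    using integral_isolated(1)[OF P] by (intro Bochner_Integration.integral_sum) auto
  also have "\<dots> = (\<Sum>\<phi>\<in>?I. \<integral>z. of_bool (P z) * (1 - cvol r m z) ^ (n - m) \<partial>tpow m)"
    using integral_isolated(2)[OF P] by (intro sum.cong) auto
  also have "\<dots> = real (card ?I) * (\<integral>z. of_bool (P z) * (1 - cvol r m z) ^ (n - m) \<partial>tpow m)"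
    by simp
  also have "real (card ?I) = (if m \<le> n then fact n / fact (n - m) else 0)"
    by (rule card_inj_PiE)
  finally show ?thesis .
qed

text \<open>The number \<open>n! / (n - m)!\<close> of injective index maps cancels the
  \<open>n!\<close> of the Poisson weight. What remains is \<open>s ^ m\<close> times an exponential
  series in \<open>s * (1 - cvol)\<close>, and with the factor \<open>exp (- s)\<close> its sum is
  \<open>exp (- s * cvol)\<close>.\<close>

lemma pp_expect_ctuples:
  fixes P :: "(nat \<Rightarrow> real^'d) \<Rightarrow> bool"
  assumes P [measurable]: "Measurable.pred (tpow m) P" and s: "s > 0"
  shows "pp_expect s (\<lambda>X. real (card (ctuples r m P X))) =
    s ^ m * (\<integral>z. of_bool (P z) * exp (- s * cvol r m z) \<partial>tpow m)"
proof -
  \<comment> \<open>Up to the factor \<open>s ^ m\<close>, this is the integrand of the Poisson term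
    with \<open>n + m\<close> points. It is dominated by the Poisson weight of \<open>n\<close>,
    which justifies exchanging sum and integral.\<close>
  define f where "f n z = exp (- s) * (of_bool (P z) * ((s * (1 - cvol r m z)) ^ n / fact n))" for n and z :: "nat \<Rightarrow> real^'d"
  let ?t = "\<lambda>n. exp (- s) * s ^ n / fact n * (\<integral>x. real (card (ctuples r m P (x ` {..<n}))) \<partial>tpow n)"
  have fm [measurable]: "f n \<in> borel_measurable (tpow m)" for n unfolding f_def by measurable
  have fb: "0 \<le> f n z" "f n z \<le> exp (- s) * (s ^ n / fact n)" for n z
  proof -
    have c: "0 \<le> s * (1 - cvol r m z)" "s * (1 - cvol r m z) \<le> s"
      using cvol_bounds[of r m z] s by (auto simp: mult_left_le)
    then show "0 \<le> f n z" by (simp add: f_def)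
    have "(s * (1 - cvol r m z)) ^ n \<le> s ^ n" using c by (intro power_mono) auto
    then show "f n z \<le> exp (- s) * (s ^ n / fact n)" using s
      by (auto simp: f_def of_bool_def intro!: divide_right_mono)
  qed
  have fi: "integrable (tpow m) (f n)" for n
    using fb by (intro integrable_tpow_bounded[where B = "exp (- s) * (s ^ n / fact n)"]) auto
  interpret P: prob_space "tpow m :: (nat \<Rightarrow> real^'d) measure" by (rule prob_space_tpow)
  have sume: "(\<lambda>n. exp (- s) * (u ^ n / fact n)) sums (exp (- s) * exp u)" for u :: real
    using exp_converges[of u] by (intro sums_mult) (simp add: field_simps)
  have fs: "(\<lambda>n. f n z) sums (of_bool (P z) * exp (- s * cvol r m z))" for z
  proof -
    have "(\<lambda>n. of_bool (P z) * (exp (- s) * ((s * (1 - cvol r m z)) ^ n / fact n))) sums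
      (of_bool (P z) * (exp (- s) * exp (s * (1 - cvol r m z))))"
      by (intro sums_mult sume)
    moreover have "exp (- s) * exp (s * (1 - cvol r m z)) = exp (- s * cvol r m z)"
      by (simp add: exp_add[symmetric] algebra_simps)
    ultimately show ?thesis by (simp add: f_def[abs_def] algebra_simps)
  qed
  have "(\<lambda>n. \<integral>z. f n z \<partial>tpow m) sums (\<integral>z. (\<Sum>n. f n z) \<partial>tpow m)"
  proof (rule sums_integral[OF fi])
    show "AE z in tpow m. summable (\<lambda>n. norm (f n z))"
      using fb(1) fs by (auto simp: sums_iff)
    show "summable (\<lambda>n. \<integral>z. norm (f n z) \<partial>tpow m)"
    proof (rule summable_comparison_test')
      show "summable (\<lambda>n. exp (- s) * (s ^ n / fact n))" using sume by (auto simp: sums_iff)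
      show "norm (\<integral>z. norm (f n z) \<partial>tpow m) \<le> exp (- s) * (s ^ n / fact n)" if "n \<ge> 0" for n
        using fb by (simp add: P.integral_le_const[OF fi])
    qed
  qed
  also have "(\<lambda>z. \<Sum>n. f n z) = (\<lambda>z. of_bool (P z) * exp (- s * cvol r m z))"
    using fs by (auto simp: sums_iff)
  finally have "(\<lambda>n. s ^ m * (\<integral>z. f n z \<partial>tpow m)) sums (s ^ m * (\<integral>z. of_bool (P z) * exp (- s * cvol r m z) \<partial>tpow m))"
    by (rule sums_mult)
  also have "(\<lambda>n. s ^ m * (\<integral>z. f n z \<partial>tpow m)) = (\<lambda>n. ?t (n + m))"
  proof
    fix n
    have "(\<integral>z. f n z \<partial>tpow m) = (\<integral>z. (exp (- s) * s ^ n / fact n) * (of_bool (P z) * (1 - cvol r m z) ^ n) \<partial>tpow m)"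
      by (intro Bochner_Integration.integral_cong) (auto simp: f_def power_mult_distrib)
    also have "\<dots> = (exp (- s) * s ^ n / fact n) * (\<integral>z. of_bool (P z) * (1 - cvol r m z) ^ n \<partial>tpow m)"
      by simp
    finally show "s ^ m * (\<integral>z. f n z \<partial>tpow m) = ?t (n + m)"
      by (simp add: integral_card_ctuples[OF P] power_add)
  qed
  finally have "(\<lambda>n. ?t (n + m)) sums (s ^ m * (\<integral>z. of_bool (P z) * exp (- s * cvol r m z) \<partial>tpow m))" .
  \<comment> \<open>Fewer than \<open>m\<close> points carry no injective \<open>m\<close>-tuple, so
    the first \<open>m\<close> terms vanish and the shift of the index loses nothing.\<close>
  then have "?t sums (s ^ m * (\<integral>z. of_bool (P z) * exp (- s * cvol r m z) \<partial>tpow m))"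
    by (rule sums_zero_iff_shift[THEN iffD1, rotated]) (simp add: integral_card_ctuples[OF P])
  then show ?thesis unfolding pp_expect_def by (simp add: sums_iff)
qed

subsection \<open>Functionals of exponential growth\<close>

text \<open>\<open>pp_expect\<close> is built from the total operations of Bochner integral and
  infinite sum, so linearity and monotonicity require integrability and summability. A bound
  \<open>a * b ^ n\<close> in the number of sampled points guarantees both against Poisson weights,
  and the class is closed under sums, products and the passage to the integrated squared
  difference.\<close>

definition tame :: "((real^'d) set \<Rightarrow> real) \<Rightarrow> bool" where
  "tame F \<longleftrightarrow> (\<forall>n. (\<lambda>x. F (x ` {..<n})) \<in> borel_measurable (tpow n)) \<and>
    (\<exists>a\<ge>0. \<exists>b\<ge>0. \<forall>n. \<forall>x\<in>space (tpow n). \<bar>F (x ` {..<n})\<bar> \<le> a * b ^ n)"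

lemma tame_measurable: "tame F \<Longrightarrow> (\<lambda>x. F (x ` {..<n})) \<in> borel_measurable (tpow n)"
  by (simp add: tame_def)

lemma tame_boundE:
  assumes "tame F"
  obtains a b where "a \<ge> 0" "b \<ge> 0" "\<And>n x. x \<in> space (tpow n) \<Longrightarrow> \<bar>F (x ` {..<n})\<bar> \<le> a * b ^ n"
  using assms unfolding tame_def by metis

lemma tame_integrable:
  assumes "tame F" shows "integrable (tpow n) (\<lambda>x. F (x ` {..<n}))"
proof -
  obtain a b where "\<And>n x. x \<in> space (tpow n) \<Longrightarrow> \<bar>F (x ` {..<n})\<bar> \<le> a * b ^ n"
    using tame_boundE[OF assms] by metis
  then show ?thesis by (rule integrable_tpow_bounded[OF tame_measurable[OF assms]])
qed

lemma tame_const: "tame (\<lambda>_ :: (real^'d) set. c)"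
proof -
  have "\<forall>n. \<forall>x\<in>space (tpow n :: (nat \<Rightarrow> real^'d) measure). \<bar>c\<bar> \<le> \<bar>c\<bar> * 1 ^ n" by simp
  then have "\<exists>a\<ge>0. \<exists>b\<ge>0. \<forall>n. \<forall>x\<in>space (tpow n :: (nat \<Rightarrow> real^'d) measure). \<bar>c\<bar> \<le> a * b ^ n"
    by (meson abs_ge_zero zero_le_one)
  then show ?thesis unfolding tame_def by simp
qed

lemma tame_mult:
  assumes "tame F" "tame G" shows "tame (\<lambda>X. F X * G X)"
proof -
  obtain a b where 1: "a \<ge> 0" "b \<ge> 0" "\<And>n x. x \<in> space (tpow n) \<Longrightarrow> \<bar>F (x ` {..<n})\<bar> \<le> a * b ^ n"
    using tame_boundE[OF assms(1)] by metis
  obtain a' b' where 2: "a' \<ge> 0" "b' \<ge> 0" "\<And>n x. x \<in> space (tpow n) \<Longrightarrow> \<bar>G (x ` {..<n})\<bar> \<le> a' * b' ^ n"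
    using tame_boundE[OF assms(2)] by metis
  have "\<bar>F (x ` {..<n}) * G (x ` {..<n})\<bar> \<le> (a * a') * (b * b') ^ n" if "x \<in> space (tpow n)" for n and x :: "nat \<Rightarrow> real^'a"
  proof -
    have "\<bar>F (x ` {..<n}) * G (x ` {..<n})\<bar> \<le> (a * b ^ n) * (a' * b' ^ n)"
      unfolding abs_mult using 1 2 that by (intro mult_mono) auto
    then show ?thesis by (simp add: power_mult_distrib mult_ac)
  qed
  moreover have "a * a' \<ge> 0" "b * b' \<ge> 0" using 1 2 by auto
  ultimately have "\<exists>a\<ge>0. \<exists>b\<ge>0. \<forall>n. \<forall>x\<in>space (tpow n). \<bar>F (x ` {..<n}) * G (x ` {..<n})\<bar> \<le> a * b ^ n"
    by blast
  then show ?thesis using assms unfolding tame_def by (auto intro!: borel_measurable_times)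
qed

lemma tame_add:
  assumes "tame F" "tame G" shows "tame (\<lambda>X. F X + G X)"
proof -
  obtain a b where 1: "a \<ge> 0" "b \<ge> 0" "\<And>n x. x \<in> space (tpow n) \<Longrightarrow> \<bar>F (x ` {..<n})\<bar> \<le> a * b ^ n"
    using tame_boundE[OF assms(1)] by metis
  obtain a' b' where 2: "a' \<ge> 0" "b' \<ge> 0" "\<And>n x. x \<in> space (tpow n) \<Longrightarrow> \<bar>G (x ` {..<n})\<bar> \<le> a' * b' ^ n"
    using tame_boundE[OF assms(2)] by metis
  have "\<bar>F (x ` {..<n}) + G (x ` {..<n})\<bar> \<le> (a + a') * (max b b') ^ n" if "x \<in> space (tpow n)" for n and x :: "nat \<Rightarrow> real^'a"
  proof -
    have "\<bar>F (x ` {..<n}) + G (x ` {..<n})\<bar> \<le> a * b ^ n + a' * b' ^ n"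
      using 1(3)[OF that] 2(3)[OF that] by linarith
    also have "\<dots> \<le> a * (max b b') ^ n + a' * (max b b') ^ n"
      using 1 2 by (intro add_mono mult_left_mono power_mono) auto
    finally show ?thesis by (simp add: algebra_simps)
  qed
  moreover have "a + a' \<ge> 0" "max b b' \<ge> 0" using 1 2 by auto
  ultimately have "\<exists>a\<ge>0. \<exists>b\<ge>0. \<forall>n. \<forall>x\<in>space (tpow n). \<bar>F (x ` {..<n}) + G (x ` {..<n})\<bar> \<le> a * b ^ n"
    by blast
  then show ?thesis using assms unfolding tame_def by (auto intro!: borel_measurable_add)
qed

lemma tame_cmult: "tame F \<Longrightarrow> tame (\<lambda>X. c * F X)"
  by (intro tame_mult tame_const)

lemma pp_expect_summable:
  assumes F: "tame F" and s: "s \<ge> 0"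
  shows "summable (\<lambda>n. exp (- s) * s ^ n / fact n * (\<integral>x. F (x ` {..<n}) \<partial>tpow n))"
proof -
  obtain a b where ab: "a \<ge> 0" "b \<ge> 0" "\<And>n x. x \<in> space (tpow n) \<Longrightarrow> \<bar>F (x ` {..<n})\<bar> \<le> a * b ^ n"
    using tame_boundE[OF F] by metis
  show ?thesis
  proof (rule summable_comparison_test')
    show "summable (\<lambda>n. exp (- s) * a * ((s * b) ^ n / fact n))"
      using exp_converges[of "s * b"] by (intro summable_mult) (auto simp: sums_iff field_simps)
    fix n :: nat
    interpret prob_space "tpow n :: (nat \<Rightarrow> real^'a) measure" by (rule prob_space_tpow)
    have "\<bar>\<integral>x. F (x ` {..<n}) \<partial>tpow n\<bar> \<le> (\<integral>x. \<bar>F (x ` {..<n})\<bar> \<partial>tpow n)"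
      by (rule integral_abs_bound)
    also have "\<dots> \<le> a * b ^ n"
      using tame_integrable[OF F] ab(3) by (intro integral_le_const AE_I2) auto
    finally have "\<bar>\<integral>x. F (x ` {..<n}) \<partial>tpow n\<bar> \<le> a * b ^ n" .
    then have "(exp (- s) * s ^ n / fact n) * \<bar>\<integral>x. F (x ` {..<n}) \<partial>tpow n\<bar> \<le> (exp (- s) * s ^ n / fact n) * (a * b ^ n)"
      using s by (intro mult_left_mono) auto
    then show "norm (exp (- s) * s ^ n / fact n * (\<integral>x. F (x ` {..<n}) \<partial>tpow n)) \<le> exp (- s) * a * ((s * b) ^ n / fact n)"
      using s by (simp add: abs_mult power_mult_distrib field_simps)
  qed
qed

lemma pp_expect_add:
  assumes "tame F" "tame G" "s \<ge> 0"
  shows "pp_expect s (\<lambda>X. F X + G X) = pp_expect s F + pp_expect s G"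
  unfolding pp_expect_def
  by (subst suminf_add[OF pp_expect_summable[OF assms(1,3)] pp_expect_summable[OF assms(2,3)]])
    (simp add: Bochner_Integration.integral_add tame_integrable assms distrib_left)

lemma pp_expect_cmult:
  assumes "tame F" "s \<ge> 0"
  shows "pp_expect s (\<lambda>X. c * F X) = c * pp_expect s F"
  unfolding pp_expect_def integral_mult_right_zero mult.left_commute[of _ c]
  by (rule suminf_mult[OF pp_expect_summable[OF assms]])

lemma pp_expect_const: "pp_expect s (\<lambda>_. c :: real) = c"
proof -
  have "(\<integral>x. c \<partial>(tpow n :: (nat \<Rightarrow> real^'a) measure)) = c" for n
  proof -
    interpret prob_space "tpow n :: (nat \<Rightarrow> real^'a) measure" by (rule prob_space_tpow)
    show ?thesis by (simp add: prob_space)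
  qed
  moreover have "(\<lambda>n. exp (- s) * (s ^ n / fact n) * c) sums (exp (- s) * exp s * c)"
    using exp_converges[of s] by (intro sums_mult sums_mult2) (simp add: field_simps)
  moreover have "exp (- s) * exp s * c = c" by (simp add: exp_minus)
  ultimately show ?thesis
    unfolding pp_expect_def by (simp only: sums_iff times_divide_eq_right)
qed

text \<open>Only finite subsets of the cube arise as samples, so the comparison is asked for these
  alone.\<close>

lemma pp_expect_mono:
  fixes F G :: "(real^'d) set \<Rightarrow> real"
  assumes "tame F" "tame G" "s \<ge> 0" and le: "\<And>X. finite X \<Longrightarrow> X \<subseteq> unit_cube \<Longrightarrow> F X \<le> G X"
  shows "pp_expect s F \<le> pp_expect s G"
  unfolding pp_expect_def
proof (intro suminf_le pp_expect_summable assms(1,2,3) mult_left_mono integral_mono tame_integrable)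
  fix n and x :: "nat \<Rightarrow> real^'d" assume "x \<in> space (tpow n)"
  then show "F (x ` {..<n}) \<le> G (x ` {..<n})" by (intro le) (auto simp: space_PiM)
qed (use \<open>s \<ge> 0\<close> in simp)

lemma pp_var_eq:
  assumes F: "tame F" and s: "s \<ge> 0"
  shows "pp_var s F = pp_expect s (\<lambda>X. (F X)\<^sup>2) - (pp_expect s F)\<^sup>2"
proof -
  define m where "m = pp_expect s F"
  have F2: "tame (\<lambda>X. (F X)\<^sup>2)" unfolding power2_eq_square by (intro tame_mult F)
  have "pp_var s F = pp_expect s (\<lambda>X. (F X)\<^sup>2 + ((- 2 * m) * F X + m\<^sup>2))"
    unfolding pp_var_def m_def[symmetric] by (simp add: power2_eq_square algebra_simps)
  also have "\<dots> = pp_expect s (\<lambda>X. (F X)\<^sup>2) + ((- 2 * m) * m + m\<^sup>2)"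
    using F F2 s by (simp only: pp_expect_add pp_expect_cmult pp_expect_const tame_add tame_cmult tame_const m_def[symmetric])
  finally show ?thesis by (simp add: m_def power2_eq_square)
qed

lemma tame_card_ctuples:
  fixes P :: "(nat \<Rightarrow> real^'d) \<Rightarrow> bool"
  assumes "Measurable.pred (tpow m) P"
  shows "tame (\<lambda>X. real (card (ctuples r m P X)))"
proof -
  have "\<bar>real (card (ctuples r m P (x ` {..<n})))\<bar> \<le> 1 * (2 ^ m) ^ n" for x :: "nat \<Rightarrow> real^'d" and n
  proof -
    have "card (ctuples r m P (x ` {..<n})) \<le> card (x ` {..<n}) ^ m" by (intro card_ctuples_le) auto
    also have "\<dots> \<le> n ^ m" using card_image_le[of "{..<n}" x] by (intro power_mono) auto
    \<comment> \<open>The crude \<open>n \<le> 2 ^ n\<close> turns polynomial growth into the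
      exponential form that \<open>tame\<close> prescribes.\<close>
    also have "\<dots> \<le> (2 ^ n) ^ m" by (intro power_mono less_imp_le[OF less_exp]) auto
    also have "\<dots> = (2 ^ m) ^ n" by (simp add: power_mult[symmetric] mult.commute)
    finally have "real (card (ctuples r m P (x ` {..<n}))) \<le> real ((2 ^ m) ^ n)" by (rule of_nat_mono)
    then show ?thesis by simp
  qed
  moreover have "(0::real) \<le> 2 ^ m" by simp
  ultimately have "\<exists>a\<ge>0. \<exists>b\<ge>0. \<forall>n. \<forall>x\<in>space (tpow n :: (nat \<Rightarrow> real^'d) measure).
      \<bar>real (card (ctuples r m P (x ` {..<n})))\<bar> \<le> a * b ^ n"
    by (metis zero_le_one)
  then show ?thesis unfolding tame_def using measurable_card_ctuples[OF assms] by blast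
qed

section \<open>Add-one differences of tame functionals\<close>

lemma measurable_addone_squared:
  fixes F :: "(real^'d) set \<Rightarrow> real"
  assumes F: "tame F"
  shows "(\<lambda>(x, y). (addone F y (x ` {..<n}))\<^sup>2) \<in> borel_measurable (tpow n \<Otimes>\<^sub>M torus_meas)"
proof -
  let ?N = "tpow n \<Otimes>\<^sub>M (torus_meas :: (real^'d) measure)"
  \<comment> \<open>Adding \<open>y\<close> to the configuration amounts to sampling one more
    coordinate, with index \<open>n\<close>, so measurability is inherited from samples of size
    \<open>Suc n\<close>.\<close>
  have "(\<lambda>(x, y). x(n := y)) \<in> ?N \<rightarrow>\<^sub>M tpow (Suc n)"
    unfolding lessThan_Suc by (rule measurable_add_dim)
  from measurable_compose[OF this tame_measurable[OF F]]
  have 1: "(\<lambda>p. F ((\<lambda>(x, y). x(n := y)) p ` {..<Suc n})) \<in> borel_measurable ?N" .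
  have 2: "(\<lambda>p. F (fst p ` {..<n})) \<in> borel_measurable ?N"
    by (rule measurable_compose[OF measurable_fst tame_measurable[OF F]])
  have eq: "(\<lambda>(x, y). (addone F y (x ` {..<n}))\<^sup>2) =
      (\<lambda>p. (F ((\<lambda>(x, y). x(n := y)) p ` {..<Suc n}) - F (fst p ` {..<n}))\<^sup>2)"
  proof -
    have "(x(n := y)) ` {..<Suc n} = insert y (x ` {..<n})" for x :: "nat \<Rightarrow> real^'d" and y
      by (auto simp: lessThan_Suc)
    then show ?thesis by (simp add: addone_def fun_eq_iff)
  qed
  show ?thesis unfolding eq by (intro borel_measurable_power borel_measurable_diff 1 2)
qed

lemma addone_squared_boundE:
  fixes F :: "(real^'d) set \<Rightarrow> real"
  assumes F: "tame F"
  obtains a b where "a \<ge> 0" "b \<ge> 0"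
    "\<And>n x y. x \<in> space (tpow n) \<Longrightarrow> y \<in> unit_cube \<Longrightarrow> (addone F y (x ` {..<n}))\<^sup>2 \<le> a * b ^ n"
proof -
  obtain a b where ab: "a \<ge> 0" "b \<ge> 0" "\<And>n x. x \<in> space (tpow n) \<Longrightarrow> \<bar>F (x ` {..<n})\<bar> \<le> a * b ^ n"
    using tame_boundE[OF F] by metis
  have "(addone F y (x ` {..<n}))\<^sup>2 \<le> (a * (b + 1))\<^sup>2 * (b\<^sup>2) ^ n"
    if x: "x \<in> space (tpow n)" and y: "y \<in> unit_cube" for n x and y :: "real^'d"
  proof -
    have xs: "x(n := y) \<in> space (tpow (Suc n))"
      using x y by (auto simp: space_PiM PiE_iff extensional_def)
    have im: "(x(n := y)) ` {..<Suc n} = insert y (x ` {..<n})" by (auto simp: lessThan_Suc)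
    have "\<bar>addone F y (x ` {..<n})\<bar> \<le> a * b ^ Suc n + a * b ^ n"
      using ab(3)[OF xs] ab(3)[OF x] unfolding im addone_def by linarith
    also have "\<dots> = (a * (b + 1)) * b ^ n" by (simp add: algebra_simps)
    finally have "\<bar>addone F y (x ` {..<n})\<bar>\<^sup>2 \<le> ((a * (b + 1)) * b ^ n)\<^sup>2" by (intro power_mono) auto
    also have "\<dots> = (a * (b + 1))\<^sup>2 * (b\<^sup>2) ^ n" by (simp add: power_mult_distrib power_mult[symmetric] mult.commute)
    finally show ?thesis by simp
  qed
  then show thesis by (intro that[of "(a * (b + 1))\<^sup>2" "b\<^sup>2"]) auto
qed

lemma integrable_addone_squared:
  fixes F :: "(real^'d) set \<Rightarrow> real"
  assumes F: "tame F" and X: "finite X" "X \<subseteq> unit_cube"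
  shows "integrable torus_meas (\<lambda>y. (addone F y X)\<^sup>2)"
proof -
  \<comment> \<open>\<open>tame\<close> speaks only of images of sample vectors, so the given finite
    set is first enumerated as such an image.\<close>
  obtain n and f :: "nat \<Rightarrow> real^'d" where f: "X = f ` {i. i < n}"
    using finite_imp_nat_seg_image_inj_on[OF X(1)] by blast
  define x where "x = restrict f {..<n}"
  have x: "x \<in> space (tpow n)" "X = x ` {..<n}"
    using f X(2) by (auto simp: x_def space_PiM image_iff)
  obtain a b where ab: "\<And>n x y. x \<in> space (tpow n) \<Longrightarrow> y \<in> unit_cube \<Longrightarrow> (addone F y (x ` {..<n}))\<^sup>2 \<le> a * b ^ n"
    using addone_squared_boundE[OF F] by metis
  have "(\<lambda>y. (addone F y (x ` {..<n}))\<^sup>2) \<in> borel_measurable torus_meas"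
    using measurable_compose[OF measurable_Pair1'[OF x(1)] measurable_addone_squared[OF F]] by simp
  then show ?thesis unfolding x(2)
    using ab[OF x(1)] by (intro torus.integrable_const_bound[where B = "a * b ^ n"] AE_I2) auto
qed

text \<open>It admits the inner integral of the Dirichlet form to the rules for comparing and
  scaling expectations.\<close>

lemma tame_dirichlet:
  fixes F :: "(real^'d) set \<Rightarrow> real"
  assumes F: "tame F"
  shows "tame (\<lambda>X. \<integral>y. (addone F y X)\<^sup>2 \<partial>torus_meas)"
proof -
  obtain a b where ab: "a \<ge> 0" "b \<ge> 0"
    "\<And>n x y. x \<in> space (tpow n) \<Longrightarrow> y \<in> unit_cube \<Longrightarrow> (addone F y (x ` {..<n}))\<^sup>2 \<le> a * b ^ n"
    using addone_squared_boundE[OF F] by metis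
  have "\<bar>\<integral>y. (addone F y (x ` {..<n}))\<^sup>2 \<partial>torus_meas\<bar> \<le> a * b ^ n" if x: "x \<in> space (tpow n)" for n x
  proof -
    have "integrable torus_meas (\<lambda>y. (addone F y (x ` {..<n}))\<^sup>2)"
      using x by (intro integrable_addone_squared[OF F]) (auto simp: space_PiM)
    then have "(\<integral>y. (addone F y (x ` {..<n}))\<^sup>2 \<partial>torus_meas) \<le> a * b ^ n"
      using ab(3)[OF x] by (intro torus.integral_le_const AE_I2) auto
    then show ?thesis by simp
  qed
  then have "\<exists>a\<ge>0. \<exists>b\<ge>0. \<forall>n. \<forall>x\<in>space (tpow n). \<bar>\<integral>y. (addone F y (x ` {..<n}))\<^sup>2 \<partial>torus_meas\<bar> \<le> a * b ^ n"
    using ab(1,2) by blast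
  moreover have "(\<lambda>x. \<integral>y. (addone F y (x ` {..<n}))\<^sup>2 \<partial>torus_meas) \<in> borel_measurable (tpow n)" for n
    using measurable_addone_squared[OF F] by (rule torus.borel_measurable_lebesgue_integral)
  ultimately show ?thesis unfolding tame_def by blast
qed

subsection \<open>Combinatorics of connected components\<close>

text \<open>A path in the abstract graph is pulled back, edge by edge, along the inverse of the
  isomorphism. Connectedness of the tuple thereby becomes available as an induction
  principle.\<close>

lemma geo_iso_reach:
  assumes G: "is_graph k G" "connected_graph k G" and iso: "geo_iso r k G x" and ij: "i < k" "j < k"
  shows "(i, j) \<in> {(a, b). a < k \<and> b < k \<and> tdist (x a) (x b) \<le> r}\<^sup>*"
proof -
  let ?R = "{(a, b). a < k \<and> b < k \<and> tdist (x a) (x b) \<le> r}"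
  obtain \<sigma> where \<sigma>: "bij_betw \<sigma> {..<k} {..<k}"
    and adj: "\<And>i j. i < k \<Longrightarrow> j < k \<Longrightarrow> i \<noteq> j \<Longrightarrow> (tdist (x i) (x j) \<le> r \<longleftrightarrow> G (\<sigma> i) (\<sigma> j))"
    using iso unfolding geo_iso_def by blast
  define \<tau> where "\<tau> = inv_into {..<k} \<sigma>"
  have \<tau>: "\<tau> c < k" "\<sigma> (\<tau> c) = c" if "c < k" for c
    using \<sigma> that bij_betw_imp_surj_on[OF \<sigma>] inv_into_into[of c \<sigma> "{..<k}"] f_inv_into_f[of c \<sigma> "{..<k}"]
    by (auto simp: \<tau>_def)
  have \<tau>\<sigma>: "\<tau> (\<sigma> a) = a" if "a < k" for a
    using \<sigma> that by (simp add: \<tau>_def bij_betw_def)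
  have \<sigma>k: "\<sigma> a < k" if "a < k" for a using bij_betwE[OF \<sigma>] that by auto
  have *: "(i, \<tau> c) \<in> ?R\<^sup>*" if "G\<^sup>*\<^sup>* (\<sigma> i) c" for c
    using that
  proof (induction rule: rtranclp_induct)
    case base
    then show ?case using \<tau>\<sigma> ij by simp
  next
    case (step c d)
    have cd: "c < k" "d < k" "c \<noteq> d" using step G(1) by (auto simp: is_graph_def)
    then have "\<tau> c \<noteq> \<tau> d" using \<tau> by metis
    then have "tdist (x (\<tau> c)) (x (\<tau> d)) \<le> r" using adj[of "\<tau> c" "\<tau> d"] \<tau> cd step by simp
    then have "(\<tau> c, \<tau> d) \<in> ?R" using \<tau> cd by simp
    with step.IH show ?case by (rule rtrancl_into_rtrancl)
  qed
  have "G\<^sup>*\<^sup>* (\<sigma> i) (\<sigma> j)" using G(2) \<sigma>k ij by (simp add: connected_graph_def)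
  from *[OF this] show ?thesis by (simp only: \<tau>\<sigma>[OF ij(2)])
qed

text \<open>A shortest path has no more steps than the relation has pairs, hence at most
  \<open>k ^ 2\<close>, and each step has length at most \<open>r\<close>. The crude count only
  enlarges the final constant.\<close>

lemma geo_iso_diameter:
  assumes "is_graph k G" "connected_graph k G" "geo_iso r k G x" "i < k" "j < k" and r: "r \<ge> 0"
  shows "tdist (x i) (x j) \<le> real k ^ 2 * r"
proof -
  let ?R = "{(a, b). a < k \<and> b < k \<and> tdist (x a) (x b) \<le> r}"
  have sub: "?R \<subseteq> {..<k} \<times> {..<k}" by auto
  then have fin: "finite ?R" by (rule finite_subset) auto
  have card: "card ?R \<le> k ^ 2" using card_mono[OF _ sub] by (simp add: power2_eq_square)
  obtain n where n: "n \<le> card ?R" "(i, j) \<in> ?R ^^ n"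
    using geo_iso_reach[OF assms(1-5)] rtrancl_finite_eq_relpow[OF fin] by auto
  have "(i, b) \<in> ?R ^^ n \<Longrightarrow> tdist (x i) (x b) \<le> real n * r" for b n
  proof (induction n arbitrary: b)
    case (Suc n)
    then obtain a where a: "(i, a) \<in> ?R ^^ n" "(a, b) \<in> ?R" by auto
    have "tdist (x i) (x b) \<le> tdist (x i) (x a) + tdist (x a) (x b)" by (rule tdist_triangle)
    also have "\<dots> \<le> real n * r + r" using Suc.IH[OF a(1)] a(2) by (intro add_mono) auto
    finally show ?case by (simp add: algebra_simps)
  qed auto
  from this[OF n(2)] have "tdist (x i) (x j) \<le> real n * r" .
  also have "\<dots> \<le> real (k ^ 2) * r" using n(1) card r by (intro mult_right_mono of_nat_mono) auto
  finally show ?thesis by simp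
qed

text \<open>Isolation of \<open>t\<close> forces every point of \<open>u\<close> within
  \<open>r\<close> of a point of \<open>t\<close> to belong to \<open>t\<close>, and this propagates
  along paths of \<open>u\<close>. Consequently two isolated connected tuples of equal size have
  either the same points or no common point.\<close>

lemma isolated_absorbs:
  assumes "is_graph k G" "connected_graph k G" "geo_iso r k G u" and u: "\<And>i. i < k \<Longrightarrow> u i \<in> X"
    and t: "(X - t ` {..<m}) \<inter> cover r m t = {}"
    and i: "i < k" "u i \<in> t ` {..<m}" and j: "j < k"
  shows "u j \<in> t ` {..<m}"
  using geo_iso_reach[OF assms(1-3) i(1) j]
proof (induction rule: rtrancl_induct)
  case (step a b)
  then obtain c where c: "c < m" "u a = t c" by auto
  with step have "u b \<in> cover r m t" by (auto simp: cover_def)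
  moreover have "u b \<in> X" using u step by auto
  ultimately show ?case using t by auto
qed (use i in simp)

text \<open>Encoding a pair of \<open>k\<close>-tuples as one \<open>2 * k\<close>-tuple makes pairs
  of components an instance of \<open>ctuples\<close>.\<close>

definition join :: "nat \<Rightarrow> (nat \<Rightarrow> 'a) \<Rightarrow> (nat \<Rightarrow> 'a) \<Rightarrow> nat \<Rightarrow> 'a" where
  "join k x y = (\<lambda>i\<in>{..<2*k}. if i < k then x i else y (i - k))"

lemma join_simps:
  "i < k \<Longrightarrow> join k x y i = x i"
  "i < k \<Longrightarrow> join k x y (k + i) = y i"
  by (auto simp: join_def)

lemma ball_double: "(\<forall>i<2*k. Q i) \<longleftrightarrow> (\<forall>i<k. Q i) \<and> (\<forall>i<k. Q (k + i))" for k :: nat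
proof safe
  fix i assume "\<forall>i<k. Q i" "\<forall>i<k. Q (k + i)" "i < 2 * k"
  then show "Q i" by (cases "i < k") (auto dest: spec[of _ "i - k"])
qed auto

lemma cover_join: "cover r (2 * k) (join k x y) = cover r k x \<union> cover r k y"
proof -
  have "z \<notin> cover r (2 * k) (join k x y) \<longleftrightarrow> z \<notin> cover r k x \<union> cover r k y" for z
    using ball_double[of k "\<lambda>i. \<not> tdist (join k x y i) z \<le> r"]
    by (auto simp: cover_def join_simps)
  then show ?thesis by blast
qed

lemma image_join: "join k x y ` {..<2*k} = x ` {..<k} \<union> y ` {..<k}"
proof -
  have "z \<notin> join k x y ` {..<2*k} \<longleftrightarrow> z \<notin> x ` {..<k} \<union> y ` {..<k}" for z
    using ball_double[of k "\<lambda>i. z \<noteq> join k x y i"]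
    by (auto simp: join_simps)
  then show ?thesis by blast
qed

text \<open>Isolation of the union from the other points is already part of \<open>ctuples\<close>.
  The last condition records what is left of the isolation of the two halves: neither comes within
  \<open>r\<close> of the other.\<close>

definition far_pair :: "real \<Rightarrow> nat \<Rightarrow> (nat \<Rightarrow> nat \<Rightarrow> bool) \<Rightarrow> (nat \<Rightarrow> real^'d) \<Rightarrow> bool" where
  "far_pair r k G t \<longleftrightarrow> geo_iso r k G t \<and> geo_iso r k G (\<lambda>i. t (k + i)) \<and>
     (\<forall>i<k. t (k + i) \<notin> cover r k t)"

lemma geo_iso_cong: "(\<And>i. i < k \<Longrightarrow> x i = y i) \<Longrightarrow> geo_iso r k G x \<longleftrightarrow> geo_iso r k G y"
  unfolding geo_iso_def by (rule ex_cong1) auto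

lemma cover_cong: "(\<And>i. i < k \<Longrightarrow> x i = y i) \<Longrightarrow> cover r k x = cover r k y"
  unfolding cover_def by auto

lemma far_pair_join:
  "far_pair r k G (join k x y) \<longleftrightarrow> geo_iso r k G x \<and> geo_iso r k G y \<and> (\<forall>i<k. y i \<notin> cover r k x)"
  using geo_iso_cong[of k "join k x y" x] geo_iso_cong[of k "\<lambda>i. join k x y (k + i)" y]
    cover_cong[of k "join k x y" x]
  by (simp add: far_pair_def join_simps)

text \<open>By \<open>isolated_absorbs\<close> a pair either shares its point set or is disjoint.
  The first kind contributes at most \<open>k ^ k\<close> partners \<open>u\<close> per
  \<open>t\<close>, namely maps into the points of \<open>t\<close>; the second kind embeds into the
  far pairs by \<open>join\<close>.\<close>

lemma card_ctuples_squared: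
  fixes X :: "(real^'d) set"
  assumes G: "is_graph k G" "connected_graph k G" and X: "finite X" and r: "r \<ge> 0" and k: "k > 0"
  shows "(card (ctuples r k (geo_iso r k G) X))\<^sup>2 \<le>
     k ^ k * card (ctuples r k (geo_iso r k G) X) + card (ctuples r (2 * k) (far_pair r k G) X)"
proof -
  let ?T = "ctuples r k (geo_iso r k G) X"
  let ?S = "{(t, u) \<in> ?T \<times> ?T. u ` {..<k} \<subseteq> t ` {..<k}}"
  let ?D = "?T \<times> ?T - ?S"
  have fT: "finite ?T" by (rule finite_ctuples[OF X])
  have TD: "t \<in> {..<k} \<rightarrow>\<^sub>E X" "inj_on t {..<k}" "geo_iso r k G t" "(X - t ` {..<k}) \<inter> cover r k t = {}"
    if "t \<in> ?T" for t using that by (auto simp: ctuples_def)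
  have "u \<in> {..<k} \<rightarrow>\<^sub>E t ` {..<k}" if "u \<in> ?T" "u ` {..<k} \<subseteq> t ` {..<k}" for t u
    using TD(1)[OF that(1)] that(2) by (simp add: PiE_iff image_subset_iff)
  then have "?S \<subseteq> (SIGMA t:?T. {..<k} \<rightarrow>\<^sub>E t ` {..<k})" by blast
  then have "card ?S \<le> card (SIGMA t:?T. {..<k} \<rightarrow>\<^sub>E t ` {..<k})"
    using fT by (intro card_mono finite_SigmaI finite_PiE) auto
  also have "\<dots> = (\<Sum>t\<in>?T. card ({..<k} \<rightarrow>\<^sub>E t ` {..<k}))"
    using fT by (intro card_SigmaI) (auto intro: finite_PiE)
  also have "\<dots> = (\<Sum>t\<in>?T. k ^ k)"
    using TD(2) by (intro sum.cong) (auto simp: card_PiE card_image)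
  finally have S: "card ?S \<le> k ^ k * card ?T" by (simp add: mult.commute)
  have "card ?D \<le> card (ctuples r (2 * k) (far_pair r k G) X)"
  proof (rule card_inj_on_le[of "\<lambda>(t, u). join k t u"])
    show "inj_on (\<lambda>(t, u). join k t u) ?D"
    proof (rule inj_onI)
      fix p q assume p: "p \<in> ?D" and q: "q \<in> ?D"
        and pq: "(\<lambda>(t, u). join k t u) p = (\<lambda>(t, u). join k t u) q"
      obtain t u t' u' where tu: "p = (t, u)" "q = (t', u')" by (meson surj_pair)
      have T: "t \<in> ?T" "u \<in> ?T" "t' \<in> ?T" "u' \<in> ?T" using p q tu by blast+
      have eq: "join k t u = join k t' u'" using pq tu by simp
      have ti: "t i = t' i" "u i = u' i" if "i < k" for i
        using fun_cong[OF eq, of i] fun_cong[OF eq, of "k + i"] that by (auto simp: join_simps)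
      have "t = t'" using TD(1)[OF T(1)] TD(1)[OF T(3)] by (rule PiE_ext) (simp add: ti)
      moreover have "u = u'" using TD(1)[OF T(2)] TD(1)[OF T(4)] by (rule PiE_ext) (simp add: ti)
      ultimately show "p = q" using tu by simp
    qed
    show "(\<lambda>(t, u). join k t u) ` ?D \<subseteq> ctuples r (2 * k) (far_pair r k G) X"
    proof (rule image_subsetI)
      fix p assume p: "p \<in> ?D"
      obtain t u where tu: "p = (t, u)" by (meson surj_pair)
      have t: "t \<in> ?T" and u: "u \<in> ?T" and n: "(t, u) \<notin> ?S" using p tu by blast+
      have "\<not> u ` {..<k} \<subseteq> t ` {..<k}" using t u n by blast
      then obtain j where j: "j < k" "u j \<notin> t ` {..<k}" by auto
      have ux: "u i \<in> X" and tx: "t i \<in> X" if "i < k" for i using TD(1)[OF u] TD(1)[OF t] that by auto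
      \<comment> \<open>One point of \<open>u\<close> outside \<open>t\<close> suffices: a common
        point would carry all of \<open>u\<close>, including \<open>u j\<close>, into
        \<open>t\<close>.\<close>
      have dis: "u i \<notin> t ` {..<k}" if "i < k" for i
        using isolated_absorbs[OF G TD(3)[OF u] ux TD(4)[OF t] that _ j(1)] j(2) by blast
      have far: "u i \<notin> cover r k t" if "i < k" for i
        using TD(4)[OF t] dis[OF that] ux[OF that] by blast
      have "join k t u \<in> {..<2*k} \<rightarrow>\<^sub>E X"
        using ux tx by (auto simp: join_def)
      moreover have "inj_on (join k t u) {..<2*k}"
      proof -
        have "t ` {..<k} \<inter> u ` {..<k} = {}"
        proof (rule equals0I)
          fix z assume "z \<in> t ` {..<k} \<inter> u ` {..<k}"
          then obtain i where "i < k" "z = u i" "z \<in> t ` {..<k}" by (elim IntE imageE) simp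
          then show False using dis[of i] by simp
        qed
        then have "card (join k t u ` {..<2*k}) = card (t ` {..<k}) + card (u ` {..<k})"
          unfolding image_join by (intro card_Un_disjoint) simp_all
        also have "\<dots> = card {..<2*k}" using TD(2)[OF t] TD(2)[OF u] by (simp add: card_image)
        finally show ?thesis by (intro eq_card_imp_inj_on) auto
      qed
      moreover have "far_pair r k G (join k t u)"
        using TD(3)[OF t] TD(3)[OF u] far by (simp add: far_pair_join)
      moreover have "(X - join k t u ` {..<2*k}) \<inter> cover r (2 * k) (join k t u) = {}"
        unfolding image_join cover_join using TD(4)[OF t] TD(4)[OF u] by blast
      ultimately show "(\<lambda>(t, u). join k t u) p \<in> ctuples r (2 * k) (far_pair r k G) X"
        unfolding tu by (simp add: ctuples_def)
    qed
  qed (rule finite_ctuples[OF X])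
  moreover have "card ?D = card (?T \<times> ?T) - card ?S"
  proof (rule card_Diff_subset)
    show "?S \<subseteq> ?T \<times> ?T" by blast
    then show "finite ?S" by (rule finite_subset) (simp add: fT)
  qed
  ultimately have "card (?T \<times> ?T) \<le> k ^ k * card ?T + card (ctuples r (2 * k) (far_pair r k G) X)"
    using S by linarith
  then show ?thesis by (simp add: power2_eq_square card_cartesian_product)
qed

text \<open>If no component lies within reach of \<open>y\<close>, the left side is 0 and whatever
  components \<open>y\<close> may create do no harm. Otherwise the new component is too large to be
  counted, so nothing is gained, and the count drops by exactly the number of destroyed
  tuples.\<close>

lemma addone_Jcomp_ge:
  fixes X :: "(real^'d) set"
  assumes G: "is_graph k G" "connected_graph k G" and X: "finite X" and y: "y \<notin> X"
  shows "real (card {t \<in> ctuples r k (geo_iso r k G) X. y \<in> cover r k t}) / (fact k)\<^sup>2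
    \<le> (addone (Jcomp r k G) y X)\<^sup>2"
proof -
  let ?T = "ctuples r k (geo_iso r k G) X"
  let ?T' = "ctuples r k (geo_iso r k G) (insert y X)"
  let ?D = "{t \<in> ?T. y \<in> cover r k t}"
  have fT: "finite ?T" by (rule finite_ctuples[OF X])
  show ?thesis
  proof (cases "?D = {}")
    case True
    then show ?thesis by (simp del: Collect_empty_eq)
  next
    case False
    then obtain t where t: "t \<in> ?T" "y \<in> cover r k t" by blast
    have TD: "t \<in> {..<k} \<rightarrow>\<^sub>E X" "inj_on t {..<k}" "geo_iso r k G t" "(X - t ` {..<k}) \<inter> cover r k t = {}"
      using t by (auto simp: ctuples_def)
    have "?T' = ?T - ?D"
    proof (intro equalityI subsetI)
      fix u assume u: "u \<in> ?T'"
      then have UD: "u \<in> {..<k} \<rightarrow>\<^sub>E insert y X" "inj_on u {..<k}" "geo_iso r k G u"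
        "(insert y X - u ` {..<k}) \<inter> cover r k u = {}" by (auto simp: ctuples_def)
      have "y \<notin> u ` {..<k}"
      proof
        assume yu: "y \<in> u ` {..<k}"
        \<comment> \<open>Isolation of \<open>u\<close> pulls the neighbour \<open>t c\<close> of
          \<open>y\<close>, and with it all of \<open>t\<close>, into \<open>u\<close>. Together
          with \<open>y\<close> these are \<open>k + 1\<close> points among the \<open>k\<close>
          points of \<open>u\<close>.\<close>
        obtain c where c: "c < k" "tdist (t c) y \<le> r" using t by (auto simp: cover_def)
        have tX: "t i \<in> insert y X" if "i < k" for i using TD(1) that by auto
        have "t c \<in> cover r k u" using yu c by (auto simp: cover_def tdist_commute)
        then have "t c \<in> u ` {..<k}" using UD(4) tX c by blast
        then have "t i \<in> u ` {..<k}" if "i < k" for i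
          using isolated_absorbs[OF G TD(3) tX UD(4) c(1) _ that] by blast
        then have "insert y (t ` {..<k}) \<subseteq> u ` {..<k}" using yu by auto
        then have "card (insert y (t ` {..<k})) \<le> card (u ` {..<k})" by (intro card_mono) auto
        moreover have "y \<notin> t ` {..<k}" using y TD(1) by auto
        ultimately show False using TD(2) UD(2) by (simp add: card_image)
      qed
      then show "u \<in> ?T - ?D" using UD by (auto simp: ctuples_def PiE_iff)
    next
      fix u assume "u \<in> ?T - ?D"
      then show "u \<in> ?T'" by (auto simp: ctuples_def PiE_iff)
    qed
    then have "card ?T' = card ?T - card ?D" using fT by (simp add: card_Diff_subset)
    moreover have "card ?D \<le> card ?T" using fT by (intro card_mono) auto
    ultimately have "real (card ?T') = real (card ?T) - real (card ?D)" by simp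
    then have "addone (Jcomp r k G) y X = - (real (card ?D) / fact k)"
      by (simp add: addone_def Jcomp_ctuples diff_divide_distrib)
    then have "(addone (Jcomp r k G) y X)\<^sup>2 = (real (card ?D))\<^sup>2 / (fact k)\<^sup>2"
      by (simp add: power_divide)
    \<comment> \<open>Being a natural number, the count is at most its square. This makes the lower
      bound linear in the number of components hit.\<close>
    moreover have "real (card ?D) \<le> (real (card ?D))\<^sup>2"
    proof -
      have "card ?D \<ge> 1" using False fT by (simp add: Suc_le_eq card_gt_0_iff del: Collect_empty_eq)
      then show ?thesis by (simp add: self_le_power)
    qed
    ultimately show ?thesis by (simp add: divide_right_mono)
  qed
qed

subsection \<open>Packing bound\<close>

lemma measurable_torus_ball_volume:
  fixes A :: "(real^'d) set"
  assumes A: "A \<in> sets borel"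
  shows "(\<lambda>v. measure torus_meas ({w. tdist v w \<le> \<rho>} \<inter> A \<inter> unit_cube)) \<in> borel_measurable torus_meas"
proof -
  let ?N = "(torus_meas :: (real^'d) measure) \<Otimes>\<^sub>M (torus_meas :: (real^'d) measure)"
  have [measurable]: "fst \<in> borel_measurable ?N" "snd \<in> borel_measurable ?N"
    by (intro measurable_torus_borel measurable_fst measurable_snd)+
  have "(\<lambda>v. emeasure torus_meas ({w. tdist v w \<le> \<rho>} \<inter> A \<inter> unit_cube)) \<in> borel_measurable torus_meas"
  proof (rule torus.measurable_emeasure)
    have "{p \<in> space ?N. tdist (fst p) (snd p) \<le> \<rho> \<and> snd p \<in> A} \<in> sets ?N"
      using A by measurable
    also have "{p \<in> space ?N. tdist (fst p) (snd p) \<le> \<rho> \<and> snd p \<in> A}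
       = {p \<in> space ?N. snd p \<in> {w. tdist (fst p) w \<le> \<rho>} \<inter> A \<inter> unit_cube}"
      by (auto simp: space_pair_measure)
    finally show "{p \<in> space ?N. snd p \<in> {w. tdist (fst p) w \<le> \<rho>} \<inter> A \<inter> unit_cube} \<in> sets ?N" .
  qed auto
  then have "(\<lambda>v. enn2real (emeasure torus_meas ({w. tdist v w \<le> \<rho>} \<inter> A \<inter> unit_cube))) \<in> borel_measurable torus_meas"
    by (rule borel_measurable_enn2real)
  then show ?thesis by (simp add: measure_def)
qed

lemma mult_exp_neg_le: "u * exp (- c * u) \<le> 1 / c" if "c > 0" for c u :: real
proof -
  have "c * u \<le> exp (c * u)" using exp_ge_add_one_self[of "c * u"] by linarith
  then have "c * u * exp (- (c * u)) \<le> exp (c * u) * exp (- (c * u))" by (intro mult_right_mono) auto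
  then show ?thesis using that by (simp add: exp_minus field_simps)
qed

text \<open>Averaging over the centres \<open>z\<close> of balls of radius \<open>r / 2\<close> replaces the volume of
  \<open>A\<close> near \<open>v\<close> by that of \<open>A\<close> near \<open>z\<close>, and then \<open>u exp (- c u) \<le> 1 / c\<close> applies
  irrespective of the shape of \<open>A\<close>.\<close>

lemma packing_bound:
  fixes A :: "(real^'d) set" and p :: "real^'d"
  assumes A: "A \<in> sets borel" and p: "p \<in> unit_cube" and r: "0 < r" "r < 1/2" and R: "R \<ge> 0" and c: "c > 0"
  defines "a \<equiv> \<lambda>v. measure torus_meas ({w. tdist v w \<le> r} \<inter> A \<inter> unit_cube)"
  shows "integrable torus_meas (\<lambda>v. of_bool (v \<in> A \<and> tdist v p \<le> R * r) * exp (- c * a v))"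
    and "c * (\<integral>v. of_bool (v \<in> A \<and> tdist v p \<le> R * r) * exp (- c * a v) \<partial>torus_meas)
      \<le> (24 * real CARD('d) * (R + 1)) ^ CARD('d)"
proof -
  let ?M = "torus_meas :: (real^'d) measure"
  define d where "d = CARD('d)"
  have d: "d \<ge> 1" by (simp add: d_def Suc_leI)
  define h where "h v = of_bool (v \<in> A \<and> tdist v p \<le> R * r) * exp (- c * a v)" for v
  define q where "q z = measure ?M ({w. tdist z w \<le> r / 2} \<inter> A \<inter> unit_cube)" for z
  define b where "b = (r / 2 / d) ^ d"
  have b: "b > 0" using r d by (simp add: b_def)
  have am [measurable]: "a \<in> borel_measurable ?M" unfolding a_def by (rule measurable_torus_ball_volume[OF A])
  have "{v \<in> space ?M. v \<in> A \<and> tdist v p \<le> R * r} = (A \<inter> {v. tdist v p \<le> R * r}) \<inter> unit_cube"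
    by auto
  also have "\<dots> \<in> sets ?M"
    using tdist_ball_borel[of p "R * r"] by (intro sets_torus_Int sets.Int A) (simp only: tdist_commute[of p])
  finally have [measurable]: "Measurable.pred ?M (\<lambda>v. v \<in> A \<and> tdist v p \<le> R * r)" by (simp add: pred_def)
  have hm [measurable]: "h \<in> borel_measurable ?M" unfolding h_def by measurable
  have h01: "0 \<le> h v" "h v \<le> 1" for v
    using c by (auto simp: h_def a_def of_bool_def)
  show int: "integrable ?M (\<lambda>v. of_bool (v \<in> A \<and> tdist v p \<le> R * r) * exp (- c * a v))"
    using h01 hm unfolding h_def by (intro torus.integrable_const_bound[where B = 1] AE_I2) auto
  interpret pair_sigma_finite ?M ?M ..
  have ball [measurable]: "{w. tdist z w \<le> \<rho>} \<inter> unit_cube \<in> sets ?M" for z \<rho>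
    by (intro sets_torus_Int) measurable
  have "ennreal b * (\<integral>\<^sup>+v. h v \<partial>?M) = (\<integral>\<^sup>+v. ennreal b * ennreal (h v) \<partial>?M)"
    by (rule nn_integral_cmult[symmetric]) measurable
  also have "\<dots> \<le> (\<integral>\<^sup>+v. \<integral>\<^sup>+z. ennreal (h v) * indicator {w. tdist v w \<le> r / 2} z \<partial>?M \<partial>?M)"
  proof (rule nn_integral_mono)
    fix v assume v: "v \<in> space ?M"
    have "b \<le> measure ?M ({w. tdist v w \<le> r / 2} \<inter> unit_cube)"
      unfolding b_def d_def using v r by (intro tball_volume_lower) auto
    then have "ennreal b * ennreal (h v) \<le> ennreal (h v) * emeasure ?M ({w. tdist v w \<le> r / 2} \<inter> unit_cube)"
      unfolding torus.emeasure_eq_measure by (subst mult.commute) (intro mult_left_mono ennreal_leI, auto)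
    also have "\<dots> = (\<integral>\<^sup>+z. ennreal (h v) * indicator ({w. tdist v w \<le> r / 2} \<inter> unit_cube) z \<partial>?M)"
      by (rule nn_integral_cmult_indicator[symmetric]) measurable
    also have "\<dots> = (\<integral>\<^sup>+z. ennreal (h v) * indicator {w. tdist v w \<le> r / 2} z \<partial>?M)"
      by (intro nn_integral_cong) (auto split: split_indicator)
    finally show "ennreal b * ennreal (h v) \<le> (\<integral>\<^sup>+z. ennreal (h v) * indicator {w. tdist v w \<le> r / 2} z \<partial>?M)" .
  qed
  also have "\<dots> = (\<integral>\<^sup>+z. \<integral>\<^sup>+v. ennreal (h v) * indicator {w. tdist v w \<le> r / 2} z \<partial>?M \<partial>?M)"
  proof (rule Fubini'[symmetric])
    have [measurable]: "fst \<in> borel_measurable (?M \<Otimes>\<^sub>M ?M)" "snd \<in> borel_measurable (?M \<Otimes>\<^sub>M ?M)"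
      by (intro measurable_torus_borel measurable_fst measurable_snd)+
    have "{q \<in> space (?M \<Otimes>\<^sub>M ?M). tdist (fst q) (snd q) \<le> r / 2} \<in> sets (?M \<Otimes>\<^sub>M ?M)"
      by measurable
    then have [measurable]: "(\<lambda>q. indicator {q \<in> space (?M \<Otimes>\<^sub>M ?M). tdist (fst q) (snd q) \<le> r / 2} q :: ennreal)
        \<in> borel_measurable (?M \<Otimes>\<^sub>M ?M)"
      by (rule borel_measurable_indicator)
    have "(\<lambda>q. ennreal (h (fst q)) * indicator {q \<in> space (?M \<Otimes>\<^sub>M ?M). tdist (fst q) (snd q) \<le> r / 2} q) \<in> borel_measurable (?M \<Otimes>\<^sub>M ?M)"
      by measurable
    then show "(\<lambda>(v, z). ennreal (h v) * indicator {w. tdist v w \<le> r / 2} z) \<in> borel_measurable (?M \<Otimes>\<^sub>M ?M)"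
      by (rule measurable_cong[THEN iffD1, rotated]) (auto split: split_indicator)
  qed
  also have "\<dots> \<le> (\<integral>\<^sup>+z. ennreal (1 / c) * indicator ({z. tdist p z \<le> (R + 1) * r} \<inter> unit_cube) z \<partial>?M)"
  proof (rule nn_integral_mono)
    fix z assume z: "z \<in> space ?M"
    have le: "ennreal (h v) * indicator {w. tdist v w \<le> r / 2} z \<le>
      ennreal (exp (- c * q z) * of_bool (tdist p z \<le> (R + 1) * r)) * indicator ({w. tdist z w \<le> r / 2} \<inter> A \<inter> unit_cube) v"
      if v: "v \<in> space ?M" for v
    proof (cases "v \<in> A \<and> tdist v p \<le> R * r \<and> tdist v z \<le> r / 2")
      case True
      have "tdist p z \<le> tdist p v + tdist v z" by (rule tdist_triangle)
      also have "\<dots> \<le> R * r + r" using True r by (intro add_mono) (auto simp: tdist_commute[of p v])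
      finally have near: "tdist p z \<le> (R + 1) * r" by (simp add: algebra_simps)
      \<comment> \<open>The ball of radius \<open>r / 2\<close> about \<open>z\<close> lies in the
        ball of radius \<open>r\<close> about \<open>v\<close>. So the weight is at most
        \<open>exp (- c * q z)\<close>, free of \<open>v\<close>, and integrating over
        \<open>v\<close> in \<open>A\<close> near \<open>z\<close> supplies the factor
        \<open>q z\<close>.\<close>
      have "tdist v w \<le> r" if "tdist z w \<le> r / 2" for w
        using tdist_triangle[of v w z] True that by linarith
      then have "q z \<le> a v" unfolding q_def a_def
        by (intro torus.finite_measure_mono sets_torus_Int sets.Int A tdist_ball_borel) auto
      then have "exp (- c * a v) \<le> exp (- c * q z)" using c by simp
      then show ?thesis using True near v by (auto simp: h_def tdist_commute[of z v] intro!: ennreal_leI)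
    next
      case False
      then show ?thesis by (auto simp: h_def split: split_indicator)
    qed
    have Aq: "{w. tdist z w \<le> r / 2} \<inter> A \<inter> unit_cube \<in> sets ?M"
      by (intro sets_torus_Int sets.Int A tdist_ball_borel)
    have "(\<integral>\<^sup>+v. ennreal (h v) * indicator {w. tdist v w \<le> r / 2} z \<partial>?M) \<le>
      (\<integral>\<^sup>+v. ennreal (exp (- c * q z) * of_bool (tdist p z \<le> (R + 1) * r)) * indicator ({w. tdist z w \<le> r / 2} \<inter> A \<inter> unit_cube) v \<partial>?M)"
      by (intro nn_integral_mono le)
    also have "\<dots> = ennreal (exp (- c * q z) * of_bool (tdist p z \<le> (R + 1) * r)) * ennreal (q z)"
      using Aq by (simp add: nn_integral_cmult_indicator torus.emeasure_eq_measure q_def)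
    also have "\<dots> = ennreal (exp (- c * q z) * of_bool (tdist p z \<le> (R + 1) * r) * q z)"
      by (rule ennreal_mult[symmetric]) (auto simp: q_def)
    also have "\<dots> \<le> ennreal ((1 / c) * of_bool (tdist p z \<le> (R + 1) * r))"
      using mult_exp_neg_le[OF c, of "q z"] by (intro ennreal_leI) (auto simp: of_bool_def mult.commute)
    also have "\<dots> = ennreal (1 / c) * indicator ({z. tdist p z \<le> (R + 1) * r} \<inter> unit_cube) z"
      using z by (auto split: split_indicator)
    finally show "(\<integral>\<^sup>+v. ennreal (h v) * indicator {w. tdist v w \<le> r / 2} z \<partial>?M) \<le>
      ennreal (1 / c) * indicator ({z. tdist p z \<le> (R + 1) * r} \<inter> unit_cube) z" .
  qed
  also have "\<dots> = ennreal (1 / c) * emeasure ?M ({z. tdist p z \<le> (R + 1) * r} \<inter> unit_cube)"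
    by (rule nn_integral_cmult_indicator) measurable
  also have "\<dots> \<le> ennreal (1 / c) * ennreal ((12 * ((R + 1) * r)) ^ d)"
    unfolding torus.emeasure_eq_measure d_def using r R p
    by (intro mult_left_mono ennreal_leI tball_volume_upper) auto
  also have "(\<integral>\<^sup>+v. h v \<partial>?M) = ennreal (\<integral>v. h v \<partial>?M)"
    using int h01 unfolding h_def[abs_def] by (intro nn_integral_eq_integral) auto
  finally have "ennreal (b * (\<integral>v. h v \<partial>?M)) \<le> ennreal (1 / c * (12 * ((R + 1) * r)) ^ d)"
    using b c by (simp add: ennreal_mult'[symmetric])
  then have "b * (\<integral>v. h v \<partial>?M) \<le> 1 / c * (12 * ((R + 1) * r)) ^ d"
    using c R r by (subst (asm) ennreal_le_iff) auto
  then have "c * (\<integral>v. h v \<partial>?M) \<le> (12 * ((R + 1) * r)) ^ d / b"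
    using b c by (simp add: field_simps)
  \<comment> \<open>The radius cancels, which makes the bound uniform in \<open>r\<close>: 12 stems
    from the upper ball volume, and \<open>2 * d\<close> from the cube of side
    \<open>r / 2 / d\<close> in the lower one.\<close>
  also have "\<dots> = (24 * real d * (R + 1)) ^ d"
  proof -
    have "12 * ((R + 1) * r) / (r / 2 / d) = 24 * real d * (R + 1)" using r d by (simp add: field_simps)
    then show ?thesis unfolding b_def power_divide[symmetric] by (simp only:)
  qed
  finally show "c * (\<integral>v. of_bool (v \<in> A \<and> tdist v p \<le> R * r) * exp (- c * a v) \<partial>torus_meas)
      \<le> (24 * real CARD('d) * (R + 1)) ^ CARD('d)"
    by (simp add: h_def d_def)
qed

section \<open>Measurability of the graph predicates and Fubini for pairs of tuples\<close>

lemma measurable_geo_iso: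
  fixes f :: "'a \<Rightarrow> nat \<Rightarrow> real^'d"
  assumes f: "\<And>i. i < k \<Longrightarrow> (\<lambda>w. f w i) \<in> borel_measurable N"
  shows "Measurable.pred N (\<lambda>w. geo_iso r k G (f w))"
proof -
  \<comment> \<open>Restricting the isomorphism to \<open>{..<k}\<close> turns the quantifier over
    all functions into one over a finite set, under which measurability is preserved.\<close>
  have eq: "geo_iso r k G x \<longleftrightarrow> (\<exists>\<sigma>\<in>{\<sigma>\<in>{..<k} \<rightarrow>\<^sub>E {..<k}. bij_betw \<sigma> {..<k} {..<k}}.
     \<forall>i\<in>{..<k}. \<forall>j\<in>{..<k}. i \<noteq> j \<longrightarrow> (tdist (x i) (x j) \<le> r \<longleftrightarrow> G (\<sigma> i) (\<sigma> j)))" for x :: "nat \<Rightarrow> real^'d"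
  proof
    assume "geo_iso r k G x"
    then obtain \<sigma> where \<sigma>: "bij_betw \<sigma> {..<k} {..<k}"
      "\<forall>i<k. \<forall>j<k. i \<noteq> j \<longrightarrow> (tdist (x i) (x j) \<le> r \<longleftrightarrow> G (\<sigma> i) (\<sigma> j))" unfolding geo_iso_def by blast
    show "\<exists>\<sigma>\<in>{\<sigma>\<in>{..<k} \<rightarrow>\<^sub>E {..<k}. bij_betw \<sigma> {..<k} {..<k}}.
     \<forall>i\<in>{..<k}. \<forall>j\<in>{..<k}. i \<noteq> j \<longrightarrow> (tdist (x i) (x j) \<le> r \<longleftrightarrow> G (\<sigma> i) (\<sigma> j))"
    proof (rule bexI[of _ "restrict \<sigma> {..<k}"])
      have "bij_betw (restrict \<sigma> {..<k}) {..<k} {..<k}"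
        using \<sigma>(1) bij_betw_cong[of "{..<k}" "restrict \<sigma> {..<k}" \<sigma>] by simp
      then show "restrict \<sigma> {..<k} \<in> {\<sigma>\<in>{..<k} \<rightarrow>\<^sub>E {..<k}. bij_betw \<sigma> {..<k} {..<k}}"
        using bij_betwE[OF \<sigma>(1)] by auto
    qed (use \<sigma>(2) in auto)
  next
    assume "\<exists>\<sigma>\<in>{\<sigma>\<in>{..<k} \<rightarrow>\<^sub>E {..<k}. bij_betw \<sigma> {..<k} {..<k}}.
     \<forall>i\<in>{..<k}. \<forall>j\<in>{..<k}. i \<noteq> j \<longrightarrow> (tdist (x i) (x j) \<le> r \<longleftrightarrow> G (\<sigma> i) (\<sigma> j))"
    then show "geo_iso r k G x" unfolding geo_iso_def by (metis (no_types, lifting) lessThan_iff mem_Collect_eq)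
  qed
  have t: "Measurable.pred N (\<lambda>w. tdist (f w i) (f w j) \<le> r)" if "i \<in> {..<k}" "j \<in> {..<k}" for i j
    unfolding pred_def using that
    by (intro borel_measurable_le borel_measurable_tdist f) auto
  have fin: "finite {\<sigma>\<in>{..<k} \<rightarrow>\<^sub>E {..<k}. bij_betw \<sigma> {..<k} {..<k}}"
    by (rule finite_subset[of _ "{..<k} \<rightarrow>\<^sub>E {..<k}"]) (auto intro: finite_PiE)
  show ?thesis unfolding eq
    by (intro pred_intros_logic pred_intros_finite finite_lessThan fin t) auto
qed

lemma measurable_far_pair: "Measurable.pred (tpow (2 * k)) (far_pair r k G)"
proof -
  have c: "(\<lambda>t. t i) \<in> tpow (2 * k) \<rightarrow>\<^sub>M borel" "(\<lambda>t. t (k + i)) \<in> tpow (2 * k) \<rightarrow>\<^sub>M borel" if "i < k" for i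
    using that by (auto intro: measurable_tpow_component)
  have eq: "far_pair r k G = (\<lambda>t. geo_iso r k G t \<and> geo_iso r k G (\<lambda>i. t (k + i)) \<and> (\<forall>i\<in>{..<k}. t (k + i) \<notin> cover r k t))"
    by (auto simp: far_pair_def fun_eq_iff)
  show ?thesis unfolding eq
    by (intro pred_intros_logic pred_intros_finite finite_lessThan measurable_geo_iso measurable_notin_cover c) auto
qed

lemma integral_tpow_double:
  fixes F :: "(nat \<Rightarrow> real^'d) \<Rightarrow> real"
  assumes F: "F \<in> borel_measurable (tpow (2 * k))" and B: "\<And>z. z \<in> space (tpow (2 * k)) \<Longrightarrow> \<bar>F z\<bar> \<le> B"
  shows "(\<integral>z. F z \<partial>tpow (2 * k)) = (\<integral>x. \<integral>y. F (join k x y) \<partial>tpow k \<partial>tpow k)"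
proof -
  have IJ: "{..<k} \<inter> {k..<2*k} = {}" "finite {..<k}" "finite {k..<2*k}" by auto
  have un: "{..<2*k} = {..<k} \<union> {k..<2*k}" by auto
  have "integrable (tpow (2 * k)) F" using F B by (rule integrable_tpow_bounded)
  then have "(\<integral>z. F z \<partial>tpow (2 * k)) = (\<integral>x. \<integral>y. F (merge {..<k} {k..<2*k} (x, y)) \<partial>PiM {k..<2*k} (\<lambda>_. torus_meas) \<partial>tpow k)"
    unfolding un by (rule tprod.product_integral_fold[OF IJ])
  also have "\<dots> = (\<integral>x. \<integral>y. F (join k x y) \<partial>tpow k \<partial>tpow k)"
  proof (rule Bochner_Integration.integral_cong[OF refl])
    fix x :: "nat \<Rightarrow> real^'d" assume x: "x \<in> space (tpow k)"
    have xi: "x i \<in> space torus_meas" if "i < k" for i using x that by (auto simp: space_PiM)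
    have "join k x \<in> tpow k \<rightarrow>\<^sub>M tpow (2 * k)"
      unfolding join_def
    proof (rule measurable_restrict)
      fix i assume i: "i \<in> {..<2*k}"
      show "(\<lambda>y. if i < k then x i else y (i - k)) \<in> tpow k \<rightarrow>\<^sub>M torus_meas"
        using i xi by (cases "i < k") (auto intro!: measurable_component_singleton)
    qed
    then have Fj: "(\<lambda>y. F (join k x y)) \<in> borel_measurable (tpow k)"
      using F by (rule measurable_compose)
    have "F (merge {..<k} {k..<2*k} (x, y)) = F (join k x (restrict (y \<circ> (\<lambda>i. k + i)) {..<k}))" for y
      by (rule arg_cong[of _ _ F]) (auto simp: merge_def join_def fun_eq_iff)
    then have "(\<integral>y. F (merge {..<k} {k..<2*k} (x, y)) \<partial>PiM {k..<2*k} (\<lambda>_. torus_meas)) =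
       (\<integral>y. F (join k x (restrict (y \<circ> (\<lambda>i. k + i)) {..<k})) \<partial>PiM {k..<2*k} (\<lambda>_. torus_meas))"
      by simp
    also have "\<dots> = (\<integral>y. F (join k x y) \<partial>tpow k)"
      by (rule integral_tpow_reindex[OF _ _ Fj]) auto
    finally show "(\<integral>y. F (merge {..<k} {k..<2*k} (x, y)) \<partial>PiM {k..<2*k} (\<lambda>_. torus_meas)) = (\<integral>y. F (join k x y) \<partial>tpow k)" .
  qed
  finally show ?thesis .
qed

subsection \<open>Variance and Dirichlet form of the component count\<close>

lemma cvol_join:
  "cvol r (2 * k) (join k x y) = cvol r k x + measure torus_meas ((cover r k y - cover r k x) \<inter> unit_cube)"
proof -
  have "cover r (2 * k) (join k x y) \<inter> unit_cube =
      (cover r k x \<inter> unit_cube) \<union> ((cover r k y - cover r k x) \<inter> unit_cube)"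
    unfolding cover_join by blast
  then show ?thesis unfolding cvol_def
    by (simp only:) (rule torus.finite_measure_Union, auto intro: sets_torus_Int)
qed

text \<open>Go from \<open>y i\<close> through \<open>y\<close> to a point near the common
  \<open>w\<close>, over \<open>w\<close> to \<open>x\<close>, and through \<open>x\<close> to
  \<open>x 0\<close>. The two diameters give \<open>2 * k ^ 2\<close> and the two hops at
  \<open>w\<close> give the 2.\<close>

lemma cover_overlap_near:
  assumes G: "is_graph k G" "connected_graph k G" and x: "geo_iso r k G x" and y: "geo_iso r k G y"
    and r: "r \<ge> 0" and w: "w \<in> cover r k x" "w \<in> cover r k y" and i: "i < k"
  shows "tdist (y i) (x 0) \<le> (2 * real k ^ 2 + 2) * r"
proof -
  obtain a where a: "a < k" "tdist (x a) w \<le> r" using w by (auto simp: cover_def)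
  obtain b where b: "b < k" "tdist (y b) w \<le> r" using w by (auto simp: cover_def)
  have "tdist (y i) (x 0) \<le> tdist (y i) (y b) + (tdist (y b) w + (tdist w (x a) + tdist (x a) (x 0)))"
    using tdist_triangle[of "y i" "x 0" "y b"] tdist_triangle[of "y b" "x 0" w] tdist_triangle[of w "x 0" "x a"]
    by linarith
  moreover have "tdist (y i) (y b) \<le> real k ^ 2 * r" using geo_iso_diameter[OF G y i b(1) r] .
  moreover have "tdist (x a) (x 0) \<le> real k ^ 2 * r" using geo_iso_diameter[OF G x a(1) _ r] i by simp
  moreover have "tdist w (x a) \<le> r" using a(2) by (simp add: tdist_commute)
  ultimately show ?thesis using b(2) by (simp add: algebra_simps)
qed

text \<open>The right-hand side of \<open>packing_bound\<close> for
  \<open>R = 2 * k ^ 2 + 2\<close>, the distance factor from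
  \<open>cover_overlap_near\<close>.\<close>

definition packing_const :: "'d::finite itself \<Rightarrow> nat \<Rightarrow> real" where
  "packing_const _ k = (24 * real CARD('d) * (2 * real k ^ 2 + 2 + 1)) ^ CARD('d)"

text \<open>Two disjoint configurations whose neighbourhoods do not meet contribute to the first
  summand. If the neighbourhoods meet, then \<open>y\<close> lies close to \<open>x\<close>, and since the new volume is at
  least the average over \<open>i\<close> of the new volume around \<open>y i\<close>, the integral over \<open>y\<close> factorises.\<close>

lemma inner_pair_bound:
  fixes x :: "nat \<Rightarrow> real^'d"
  assumes G: "is_graph k G" "connected_graph k G" and k: "k > 0" and r: "0 < r" "r < 1/2" and s: "s > 0"
    and x: "geo_iso r k G x" "x 0 \<in> unit_cube"
  shows "(\<integral>y. of_bool (far_pair r k G (join k x y)) * exp (- s * cvol r (2 * k) (join k x y)) \<partial>tpow k)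
    \<le> exp (- s * cvol r k x) * ((\<integral>y. of_bool (geo_iso r k G y) * exp (- s * cvol r k y) \<partial>(tpow k :: (nat \<Rightarrow> real^'d) measure))
        + (packing_const TYPE('d) k * real k / s) ^ k)"
proof -
  define A where "A = - cover r k x"
  define a where "a v = measure torus_meas ({w. tdist v w \<le> r} \<inter> A \<inter> unit_cube)" for v
  \<comment> \<open>The average over \<open>k\<close> points costs a factor \<open>k\<close>:
    \<open>s\<close> times the new volume is at least \<open>c\<close> times the sum of the
    \<open>a (y i)\<close>. Hence the \<open>real k / s\<close> in the bound.\<close>
  define c where "c = s / k"
  define R where "R = 2 * real k ^ 2 + 2"
  define h where "h v = of_bool (v \<in> A \<and> tdist v (x 0) \<le> R * r) * exp (- c * a v)" for v
  have A: "A \<in> sets borel" unfolding A_def using cover_borel[of r k x] by (rule borel_comp)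
  have c: "c > 0" using s k by (simp add: c_def)
  have R: "R \<ge> 0" by (simp add: R_def)
  note pb = packing_bound[OF A x(2) r R c, folded a_def, folded h_def]
  have h0: "0 \<le> h v" for v by (simp add: h_def)
  have hint: "integrable torus_meas h" using pb(1) by (simp add: h_def[abs_def])
  have hI: "(\<integral>v. h v \<partial>torus_meas) \<le> packing_const TYPE('d) k * real k / s"
  proof -
    have "c * (\<integral>v. h v \<partial>torus_meas) \<le> packing_const TYPE('d) k"
      using pb(2) by (simp add: packing_const_def R_def)
    then show ?thesis using s k by (simp add: c_def field_simps)
  qed
  let ?g = "\<lambda>y :: nat \<Rightarrow> real^'d. of_bool (geo_iso r k G y) * exp (- s * cvol r k y)"
  have gm: "?g \<in> borel_measurable (tpow k)"
  proof -
    have [measurable]: "Measurable.pred (tpow k) (\<lambda>y. geo_iso r k G y)"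
      by (intro measurable_geo_iso measurable_tpow_component) auto
    show ?thesis by measurable
  qed
  have g1: "\<bar>?g y\<bar> \<le> 1" for y using s cvol_bounds[of r k y] by (auto simp: of_bool_def)
  have gint: "integrable (tpow k) ?g" using gm g1 by (rule integrable_tpow_bounded)
  have pint: "integrable (tpow k) (\<lambda>y. \<Prod>i<k. h (y i))"
    by (rule tprod.product_integrable_prod) (auto simp: hint)
  \<comment> \<open>Both alternatives, disjoint and overlapping neighbourhoods, are covered by
    adding the two nonnegative majorants, so the domain of integration need not be split.\<close>
  have le: "of_bool (far_pair r k G (join k x y)) * exp (- s * cvol r (2 * k) (join k x y))
     \<le> exp (- s * cvol r k x) * (?g y + (\<Prod>i<k. h (y i)))" for y
  proof (cases "far_pair r k G (join k x y)")
    case False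
    then show ?thesis using h0 by (auto simp: prod_nonneg)
  next
    case True
    then have y: "geo_iso r k G y" "\<And>i. i < k \<Longrightarrow> y i \<in> A" by (auto simp: far_pair_join A_def)
    have "exp (- s * measure torus_meas ((cover r k y - cover r k x) \<inter> unit_cube)) \<le> ?g y + (\<Prod>i<k. h (y i))"
    proof (cases "cover r k x \<inter> cover r k y \<inter> unit_cube = {}")
      case True
      then have "(cover r k y - cover r k x) \<inter> unit_cube = cover r k y \<inter> unit_cube" by blast
      then have "exp (- s * measure torus_meas ((cover r k y - cover r k x) \<inter> unit_cube)) = ?g y"
        using y(1) by (simp add: cvol_def)
      then show ?thesis using h0 by (simp add: prod_nonneg)
    next
      case False
      then obtain w where w: "w \<in> cover r k x" "w \<in> cover r k y" by blast
      have near: "tdist (y i) (x 0) \<le> R * r" if "i < k" for i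
        unfolding R_def using cover_overlap_near[OF G x(1) y(1) _ w that] r by simp
      have av: "a (y i) \<le> measure torus_meas ((cover r k y - cover r k x) \<inter> unit_cube)" if "i < k" for i
        unfolding a_def A_def using that
        by (intro torus.finite_measure_mono sets_torus_Int sets.Diff cover_borel) (auto simp: cover_def)
      have "(\<Sum>i<k. a (y i)) \<le> real k * measure torus_meas ((cover r k y - cover r k x) \<inter> unit_cube)"
        using sum_bounded_above[of "{..<k}" "\<lambda>i. a (y i)"] av by simp
      then have "c * (\<Sum>i<k. a (y i)) \<le> s * measure torus_meas ((cover r k y - cover r k x) \<inter> unit_cube)"
        using mult_left_mono[of _ _ c] c k by (fastforce simp: c_def)
      then have "exp (- s * measure torus_meas ((cover r k y - cover r k x) \<inter> unit_cube)) \<le> exp (\<Sum>i<k. - c * a (y i))"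
        by (simp add: sum_distrib_left sum_negf)
      also have "\<dots> = (\<Prod>i<k. exp (- c * a (y i)))" by (rule exp_sum) simp
      also have "\<dots> = (\<Prod>i<k. h (y i))" using near y(2) by (intro prod.cong) (auto simp: h_def)
      finally have "exp (- s * measure torus_meas ((cover r k y - cover r k x) \<inter> unit_cube)) \<le> (\<Prod>i<k. h (y i))" .
      moreover have "0 \<le> ?g y" by simp
      ultimately show ?thesis by linarith
    qed
    then have "exp (- s * cvol r k x) * exp (- s * measure torus_meas ((cover r k y - cover r k x) \<inter> unit_cube))
       \<le> exp (- s * cvol r k x) * (?g y + (\<Prod>i<k. h (y i)))" by (intro mult_left_mono) auto
    moreover have "exp (- s * cvol r (2 * k) (join k x y)) =
        exp (- s * cvol r k x) * exp (- s * measure torus_meas ((cover r k y - cover r k x) \<inter> unit_cube))"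
      unfolding cvol_join by (simp add: exp_add[symmetric] algebra_simps)
    ultimately show ?thesis using True by (simp only: of_bool_eq mult_1_left simp_thms)
  qed
  have "(\<integral>y. of_bool (far_pair r k G (join k x y)) * exp (- s * cvol r (2 * k) (join k x y)) \<partial>tpow k)
    \<le> (\<integral>y. exp (- s * cvol r k x) * (?g y + (\<Prod>i<k. h (y i))) \<partial>tpow k)"
  proof (rule integral_mono')
    show "integrable (tpow k) (\<lambda>y. exp (- s * cvol r k x) * (?g y + (\<Prod>i<k. h (y i))))"
      by (intro integrable_mult_right Bochner_Integration.integrable_add gint pint)
    show "0 \<le> exp (- s * cvol r k x) * (?g y + (\<Prod>i<k. h (y i)))" for y
      using h0 by (auto simp: prod_nonneg)
  qed (rule le)
  also have "\<dots> = exp (- s * cvol r k x) * ((\<integral>y. ?g y \<partial>tpow k) + (\<integral>y. (\<Prod>i<k. h (y i)) \<partial>tpow k))"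
    by (simp only: integral_mult_right_zero Bochner_Integration.integral_add[OF gint pint])
  also have "(\<integral>y. (\<Prod>i<k. h (y i)) \<partial>tpow k) = (\<integral>v. h v \<partial>torus_meas) ^ k"
    by (subst tprod.product_integral_prod) (auto simp: hint)
  also have "exp (- s * cvol r k x) * ((\<integral>y. ?g y \<partial>tpow k) + (\<integral>v. h v \<partial>torus_meas) ^ k)
    \<le> exp (- s * cvol r k x) * ((\<integral>y. ?g y \<partial>tpow k) + (packing_const TYPE('d) k * real k / s) ^ k)"
    using hI h0 by (intro mult_left_mono add_left_mono power_mono) auto
  finally show ?thesis .
qed

lemma far_pair_integral_bound:
  fixes k :: nat
  assumes G: "is_graph k G" "connected_graph k G" and k: "k > 0" and r: "0 < r" "r < 1/2" and s: "s > 0"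
  defines "I \<equiv> \<integral>z. of_bool (geo_iso r k G z) * exp (- s * cvol r k z) \<partial>(tpow k :: (nat \<Rightarrow> real^'d) measure)"
  shows "(\<integral>z. of_bool (far_pair r k G z) * exp (- s * cvol r (2 * k) z) \<partial>(tpow (2 * k) :: (nat \<Rightarrow> real^'d) measure))
    \<le> I * (I + (packing_const TYPE('d) k * real k / s) ^ k)"
proof -
  define K where "K = I + (packing_const TYPE('d) k * real k / s) ^ k"
  let ?g = "\<lambda>z :: nat \<Rightarrow> real^'d. of_bool (geo_iso r k G z) * exp (- s * cvol r k z)"
  let ?F = "\<lambda>z :: nat \<Rightarrow> real^'d. of_bool (far_pair r k G z) * exp (- s * cvol r (2 * k) z)"
  have gm: "?g \<in> borel_measurable (tpow k)"
  proof -
    have [measurable]: "Measurable.pred (tpow k) (\<lambda>y :: nat \<Rightarrow> real^'d. geo_iso r k G y)"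
      by (intro measurable_geo_iso measurable_tpow_component) auto
    show ?thesis by measurable
  qed
  have g1: "\<bar>?g y\<bar> \<le> 1" for y using s cvol_bounds[of r k y] by (auto simp: of_bool_def)
  have gint: "integrable (tpow k) ?g" using gm g1 by (rule integrable_tpow_bounded)
  have Fm: "?F \<in> borel_measurable (tpow (2 * k))"
  proof -
    note [measurable] = measurable_far_pair[where k = k and r = r and G = G]
    show ?thesis by measurable
  qed
  have "I \<ge> 0" unfolding I_def by (intro Bochner_Integration.integral_nonneg) auto
  moreover have "packing_const TYPE('d) k \<ge> 0" by (simp add: packing_const_def)
  ultimately have K0: "K \<ge> 0" using s by (simp add: K_def)
  have "(\<integral>z. ?F z \<partial>tpow (2 * k)) = (\<integral>x. \<integral>y. ?F (join k x y) \<partial>tpow k \<partial>tpow k)"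
    using s cvol_bounds(1) by (intro integral_tpow_double[OF Fm, where B = 1]) (auto simp: of_bool_def intro!: mult_nonneg_nonneg)
  also have "\<dots> \<le> (\<integral>x. ?g x * K \<partial>tpow k)"
  proof (rule integral_mono')
    show "integrable (tpow k) (\<lambda>x. ?g x * K)" using gint by (rule integrable_mult_left)
    show "0 \<le> ?g x * K" for x using K0 by simp
    fix x :: "nat \<Rightarrow> real^'d" assume xs: "x \<in> space (tpow k)"
    show "(\<integral>y. ?F (join k x y) \<partial>tpow k) \<le> ?g x * K"
    proof (cases "geo_iso r k G x")
      case True
      moreover have "x 0 \<in> unit_cube" using xs k by (auto simp: space_PiM)
      ultimately show ?thesis
        using inner_pair_bound[OF G k r s, of x] by (simp add: K_def I_def)
    next
      case False
      then have "?F (join k x y) = 0" for y by (simp add: far_pair_join)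
      then show ?thesis using False by simp
    qed
  qed
  also have "\<dots> = I * K" by (simp add: I_def)
  finally show ?thesis unfolding K_def .
qed

lemma tame_Jcomp: "tame (Jcomp r k G :: (real^'d) set \<Rightarrow> real)"
  and tame_components: "tame (\<lambda>X :: (real^'d) set. real (card (ctuples r k (geo_iso r k G) X)))"
proof -
  have "Measurable.pred (tpow k) (geo_iso r k G :: (nat \<Rightarrow> real^'d) \<Rightarrow> bool)"
    by (intro measurable_geo_iso measurable_tpow_component) auto
  then show *: "tame (\<lambda>X :: (real^'d) set. real (card (ctuples r k (geo_iso r k G) X)))" by (rule tame_card_ctuples)
  have J: "Jcomp r k G = (\<lambda>X :: (real^'d) set. (1 / fact k) * real (card (ctuples r k (geo_iso r k G) X)))"
    by (simp add: Jcomp_ctuples fun_eq_iff)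
  show "tame (Jcomp r k G :: (real^'d) set \<Rightarrow> real)" unfolding J by (rule tame_cmult[OF *])
qed

text \<open>The far pairs produce the square of the mean, which the variance subtracts. What remains
  is linear in the mean: \<open>k ^ k\<close> from coinciding point sets and \<open>p ^ k\<close>
  from neighbouring components.\<close>

lemma pp_var_Jcomp_le:
  fixes k :: nat
  assumes G: "is_graph k G" "connected_graph k G" and k: "k > 0" and r: "0 < r" "r < 1/2" and s: "s > 0"
  shows "pp_var s (Jcomp r k G :: (real^'d) set \<Rightarrow> real) \<le>
    (real (k ^ k) + (packing_const TYPE('d) k * real k) ^ k) / (fact k)\<^sup>2 *
      pp_expect s (\<lambda>X :: (real^'d) set. real (card (ctuples r k (geo_iso r k G) X)))"
proof -
  let ?N = "\<lambda>X :: (real^'d) set. real (card (ctuples r k (geo_iso r k G) X))"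
  let ?N2 = "\<lambda>X :: (real^'d) set. real (card (ctuples r (2 * k) (far_pair r k G) X))"
  define E where "E = pp_expect s ?N"
  define p where "p = packing_const TYPE('d) k * real k"
  define I where "I = (\<integral>z. of_bool (geo_iso r k G z) * exp (- s * cvol r k z) \<partial>(tpow k :: (nat \<Rightarrow> real^'d) measure))"
  have gp: "Measurable.pred (tpow k) (geo_iso r k G :: (nat \<Rightarrow> real^'d) \<Rightarrow> bool)"
    by (intro measurable_geo_iso measurable_tpow_component) auto
  have EI: "E = s ^ k * I" unfolding E_def I_def by (rule pp_expect_ctuples[OF gp s])
  have tN: "tame ?N" by (rule tame_components)
  have tN2: "tame ?N2" by (rule tame_card_ctuples[OF measurable_far_pair])
  have s0: "s \<ge> 0" using s by simp
  have J: "Jcomp r k G = (\<lambda>X :: (real^'d) set. (1 / fact k) * ?N X)"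
    by (simp add: Jcomp_ctuples fun_eq_iff)
  have tNN: "tame (\<lambda>X. (?N X)\<^sup>2)" unfolding power2_eq_square by (intro tame_mult tN)
  have EJ: "pp_expect s (Jcomp r k G :: (real^'d) set \<Rightarrow> real) = (1 / fact k) * E"
    unfolding J E_def by (rule pp_expect_cmult[OF tN s0])
  have EJ2: "pp_expect s (\<lambda>X :: (real^'d) set. (Jcomp r k G X)\<^sup>2) = (1 / (fact k)\<^sup>2) * pp_expect s (\<lambda>X. (?N X)\<^sup>2)"
  proof -
    have "(\<lambda>X :: (real^'d) set. (Jcomp r k G X)\<^sup>2) = (\<lambda>X. (1 / (fact k)\<^sup>2) * (?N X)\<^sup>2)"
      unfolding J by (simp add: power_divide)
    then show ?thesis by (simp only: pp_expect_cmult[OF tNN s0])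
  qed
  have "pp_expect s (\<lambda>X. (?N X)\<^sup>2) \<le> pp_expect s (\<lambda>X. real (k ^ k) * ?N X + ?N2 X)"
  proof (rule pp_expect_mono[OF tNN tame_add[OF tame_cmult[OF tN] tN2] s0])
    fix X :: "(real^'d) set" assume "finite X"
    then have "(card (ctuples r k (geo_iso r k G) X))\<^sup>2 \<le>
     k ^ k * card (ctuples r k (geo_iso r k G) X) + card (ctuples r (2 * k) (far_pair r k G) X)"
      using r k by (intro card_ctuples_squared[OF G]) auto
    then show "(?N X)\<^sup>2 \<le> real (k ^ k) * ?N X + ?N2 X"
      by (simp only: of_nat_power[symmetric] of_nat_mult[symmetric] of_nat_add[symmetric] of_nat_le_iff)
  qed
  also have "\<dots> = real (k ^ k) * E + pp_expect s ?N2"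
    by (simp only: pp_expect_add[OF tame_cmult[OF tN] tN2 s0] pp_expect_cmult[OF tN s0] E_def)
  also have "pp_expect s ?N2 \<le> E\<^sup>2 + p ^ k * E"
  proof -
    have "pp_expect s ?N2 = s ^ (2 * k) * (\<integral>z. of_bool (far_pair r k G z) * exp (- s * cvol r (2 * k) z) \<partial>(tpow (2 * k) :: (nat \<Rightarrow> real^'d) measure))"
      by (rule pp_expect_ctuples[OF measurable_far_pair s])
    also have "\<dots> \<le> s ^ (2 * k) * (I * (I + (p / s) ^ k))"
      unfolding I_def p_def using s by (intro mult_left_mono far_pair_integral_bound[OF G k r s]) auto
    \<comment> \<open>The powers of \<open>s\<close> match: \<open>s ^ (2 * k) * I * I\<close> is
      \<open>E\<^sup>2\<close>, and in the other term one factor \<open>s ^ k\<close> cancels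
      against \<open>(p / s) ^ k\<close>.\<close>
    also have "\<dots> = E\<^sup>2 + p ^ k * E"
    proof -
      define S where "S = s ^ k"
      have "S \<noteq> 0" "s ^ (2 * k) = S * S" using s by (simp_all add: S_def mult_2 power_add)
      then show ?thesis
        unfolding EI power_divide S_def[symmetric] by (simp add: power2_eq_square field_simps)
    qed
    finally show ?thesis .
  qed
  finally have "pp_expect s (\<lambda>X. (?N X)\<^sup>2) - E\<^sup>2 \<le> (real (k ^ k) + p ^ k) * E" by (simp add: algebra_simps)
  then have "(pp_expect s (\<lambda>X. (?N X)\<^sup>2) - E\<^sup>2) / (fact k)\<^sup>2 \<le> (real (k ^ k) + p ^ k) * E / (fact k)\<^sup>2"
    by (intro divide_right_mono) auto
  then show ?thesis
    unfolding pp_var_eq[OF tame_Jcomp s0] EJ EJ2 p_def[symmetric] E_def[symmetric]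
    by (simp add: power_divide power_mult_distrib diff_divide_distrib)
qed

text \<open>Double counting: integrating over \<open>y\<close> the number of tuples hit by
  \<open>y\<close> equals summing over tuples the volume of their neighbourhoods. Each neighbourhood
  contains the ball about the first point of its tuple.\<close>

lemma dirichlet_Jcomp_ge:
  fixes X :: "(real^'d) set"
  assumes G: "is_graph k G" "connected_graph k G" and k: "k > 0" and r: "0 < r" "r < 1/2"
    and X: "finite X" "X \<subseteq> unit_cube"
  shows "(r / CARD('d)) ^ CARD('d) / (fact k)\<^sup>2 * real (card (ctuples r k (geo_iso r k G) X))
    \<le> (\<integral>y. (addone (Jcomp r k G) y X)\<^sup>2 \<partial>torus_meas)"
proof -
  let ?T = "ctuples r k (geo_iso r k G) X"
  have fT: "finite ?T" by (rule finite_ctuples[OF X(1)])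
  have cs: "cover r k t \<inter> unit_cube \<in> sets torus_meas" for t :: "nat \<Rightarrow> real^'d"
    by (intro sets_torus_Int cover_borel)
  have int: "integrable torus_meas (\<lambda>y. (addone (Jcomp r k G) y X)\<^sup>2)"
    by (rule integrable_addone_squared[OF tame_Jcomp X])
  have tcube: "t 0 \<in> unit_cube" if "t \<in> ?T" for t using that X(2) k by (auto simp: ctuples_def)
  have "(r / CARD('d)) ^ CARD('d) * real (card ?T) = (\<Sum>t\<in>?T. (r / CARD('d)) ^ CARD('d))" by simp
  also have "\<dots> \<le> (\<Sum>t\<in>?T. measure torus_meas (cover r k t \<inter> unit_cube))"
  proof (rule sum_mono)
    fix t assume t: "t \<in> ?T"
    have "(r / CARD('d)) ^ CARD('d) \<le> measure torus_meas ({y. tdist (t 0) y \<le> r} \<inter> unit_cube)"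
      by (intro tball_volume_lower tcube[OF t] r)
    also have "\<dots> \<le> measure torus_meas (cover r k t \<inter> unit_cube)"
      using k by (intro torus.finite_measure_mono cs) (auto simp: cover_def)
    finally show "(r / CARD('d)) ^ CARD('d) \<le> measure torus_meas (cover r k t \<inter> unit_cube)" .
  qed
  also have "\<dots> = (\<integral>y. (\<Sum>t\<in>?T. indicator (cover r k t \<inter> unit_cube) y) \<partial>torus_meas)"
    using cs by (subst Bochner_Integration.integral_sum)
      (auto simp: Int_absorb2 intro!: sum.cong integrable_real_indicator torus.emeasure_finite simp: less_top[symmetric])
  finally have "(r / CARD('d)) ^ CARD('d) * real (card ?T) / (fact k)\<^sup>2 \<le>
     (\<integral>y. (\<Sum>t\<in>?T. indicator (cover r k t \<inter> unit_cube) y) \<partial>torus_meas) / (fact k)\<^sup>2"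
    by (rule divide_right_mono) simp
  also have "\<dots> = (\<integral>y. (\<Sum>t\<in>?T. indicator (cover r k t \<inter> unit_cube) y) / (fact k)\<^sup>2 \<partial>torus_meas)"
    by simp
  also have "\<dots> \<le> (\<integral>y. (addone (Jcomp r k G) y X)\<^sup>2 \<partial>torus_meas)"
  proof (rule integral_mono_AE[OF _ int])
    show "integrable torus_meas (\<lambda>y. (\<Sum>t\<in>?T. indicator (cover r k t \<inter> unit_cube) y) / (fact k)\<^sup>2 :: real)"
      using cs by (intro integrable_divide Bochner_Integration.integrable_sum integrable_real_indicator)
        (auto simp: less_top[symmetric])
    \<comment> \<open>The pointwise bound holds for \<open>y\<close> outside \<open>X\<close>, and a
      finite set is null.\<close>
    have "X \<in> null_sets torus_meas"
    proof -
      have "X = (\<Union>x\<in>X. {x})" by simp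
      also have "\<dots> \<in> null_sets torus_meas"
      proof (rule null_sets_UN')
        show "countable X" using X(1) by (rule countable_finite)
        fix x assume "x \<in> X"
        then show "{x} \<in> null_sets torus_meas"
          using sets_torus_Int[of "{x}"] X(2) emeasure_torus_singleton[of x] by (intro null_setsI) auto
      qed
      finally show ?thesis .
    qed
    then have "AE y in torus_meas. y \<notin> X" by (rule AE_not_in)
    then show "AE y in torus_meas. (\<Sum>t\<in>?T. indicator (cover r k t \<inter> unit_cube) y) / (fact k)\<^sup>2 \<le> (addone (Jcomp r k G) y X)\<^sup>2"
    proof (rule AE_mp[OF _ AE_I2], intro impI)
      fix y assume y: "y \<in> space torus_meas" "y \<notin> X"
      have "(\<Sum>t\<in>?T. indicator (cover r k t \<inter> unit_cube) y :: real) = (\<Sum>t\<in>?T. of_bool (y \<in> cover r k t))"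
        using y by (intro sum.cong) (auto split: split_indicator)
      also have "\<dots> = real (card {t \<in> ?T. y \<in> cover r k t})"
        using fT by (simp add: sum_of_bool_eq Int_def)
      finally show "(\<Sum>t\<in>?T. indicator (cover r k t \<inter> unit_cube) y) / (fact k)\<^sup>2 \<le> (addone (Jcomp r k G) y X)\<^sup>2"
        using addone_Jcomp_ge[OF G X(1) y(2)] by simp
    qed
  qed
  finally show ?thesis by simp
qed

section \<open>Comparison of the two bounds\<close>

lemma set_integral_unit_cube:
  fixes f :: "real^'d \<Rightarrow> real"
  shows "(LINT x:unit_cube|lborel. f x) = (\<integral>x. f x \<partial>torus_meas)"
  unfolding torus_meas_def set_lebesgue_integral_def
  by (subst integral_restrict_space) auto

theorem theorem3p3:
  fixes k :: nat
  assumes "k \<ge> 2"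
  shows "\<exists>C::real. 0 < C \<and>
    (\<forall>(r :: real \<Rightarrow> real) (G :: nat \<Rightarrow> nat \<Rightarrow> bool).
       (\<forall>s>0. 0 < r s \<and> r s < 1/2) \<and>
       filterlim (\<lambda>s. s * r s ^ CARD('d)) at_top at_top \<and>
       is_graph k G \<and> connected_graph k G \<and>
       (\<forall>s>0. feasible TYPE('d::finite) (r s) k G)
       \<longrightarrow>
       (\<forall>s>0. pp_var s (Jcomp (r s) k G :: (real^'d) set \<Rightarrow> real)
          \<le> C / (s * r s ^ CARD('d)) *
             pp_expect s (\<lambda>X::(real^'d) set.
                s * (LINT x:unit_cube|lborel. (addone (Jcomp (r s) k G) x X)\<^sup>2))))"
proof -
  define B where "B = real (k ^ k) + (packing_const TYPE('d) k * real k) ^ k"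
  define d where "d = CARD('d)"
  have k: "k > 0" using assms by simp
  have B: "B > 0"
  proof -
    have "packing_const TYPE('d) k \<ge> 0" by (simp add: packing_const_def)
    then have "(packing_const TYPE('d) k * real k) ^ k \<ge> 0" by simp
    moreover have "real (k ^ k) > 0" using k by simp
    ultimately show ?thesis unfolding B_def by linarith
  qed
  have d: "real d > 0" by (simp add: d_def)
  have main: "pp_var s (Jcomp \<rho> k G :: (real^'d) set \<Rightarrow> real)
      \<le> (B * real d ^ d) / (s * \<rho> ^ d) *
         pp_expect s (\<lambda>X::(real^'d) set. s * (LINT x:unit_cube|lborel. (addone (Jcomp \<rho> k G) x X)\<^sup>2))"
    if s: "s > 0" and \<rho>: "0 < \<rho>" "\<rho> < 1/2" and G: "is_graph k G" "connected_graph k G" for s \<rho> G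
  proof -
    let ?N = "\<lambda>X :: (real^'d) set. real (card (ctuples \<rho> k (geo_iso \<rho> k G) X))"
    let ?D = "\<lambda>X :: (real^'d) set. \<integral>y. (addone (Jcomp \<rho> k G) y X)\<^sup>2 \<partial>torus_meas"
    define q where "q = (\<rho> / d) ^ d / (fact k)\<^sup>2"
    have s0: "s \<ge> 0" using s by simp
    have tD: "tame ?D" by (rule tame_dirichlet[OF tame_Jcomp])
    have "q * pp_expect s ?N = pp_expect s (\<lambda>X. q * ?N X)"
      by (rule pp_expect_cmult[OF tame_components s0, symmetric])
    also have "\<dots> \<le> pp_expect s ?D"
      unfolding q_def d_def
      by (intro pp_expect_mono tame_cmult tame_components tD s0 dirichlet_Jcomp_ge G k \<rho>)
    finally have le: "q * pp_expect s ?N \<le> pp_expect s ?D" .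
    have "pp_var s (Jcomp \<rho> k G :: (real^'d) set \<Rightarrow> real) \<le> B / (fact k)\<^sup>2 * pp_expect s ?N"
      unfolding B_def by (rule pp_var_Jcomp_le[OF G k \<rho> s])
    \<comment> \<open>Upper and lower bound carry the same normalisation
      \<open>(fact k)\<^sup>2\<close>, which cancels; the ratio of the two constants is
      \<open>B * real d ^ d / \<rho> ^ d\<close>.\<close>
    also have "\<dots> = (B * real d ^ d / \<rho> ^ d) * (q * pp_expect s ?N)"
      using \<rho> d by (simp add: q_def power_divide)
    also have "\<dots> \<le> (B * real d ^ d / \<rho> ^ d) * pp_expect s ?D"
      using B \<rho> by (intro mult_left_mono le) auto
    \<comment> \<open>The \<open>s\<close> in the denominator is offset by the intensity
      \<open>s\<close> in the Dirichlet form, which leaves a constant that depends on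
      \<open>d\<close> and \<open>k\<close> only.\<close>
    also have "\<dots> = (B * real d ^ d) / (s * \<rho> ^ d) * (s * pp_expect s ?D)"
      using s by simp
    also have "s * pp_expect s ?D = pp_expect s (\<lambda>X. s * ?D X)"
      by (rule pp_expect_cmult[OF tD s0, symmetric])
    finally show ?thesis unfolding set_integral_unit_cube .
  qed
  show ?thesis
    by (rule exI[of _ "B * real d ^ d"]) (use B d main in \<open>auto simp: d_def\<close>)
qed

end
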